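(* Let $H(q,p)$ be a nondegenerate autonomous Hamiltonian and let $g(q,p)$ be a $C^1$ autonomous monitor function such that $$\det\left(\frac{\partial H}{\partial p}\nabla_pg(q,p)^\top+g(q,p)\frac{\partial^2H}{\partial p^2}+\nabla_pg(q,p)\frac{\partial H}{\partial p}^\top\right)\neq0 .$$ Let $\bar H(\bar q,\bar p)=g(q,p)\,(H(q,p)+p^t)$ be the Poincaré transformed Hamiltonian on the extended phase space, with exact discrete right and left Hamiltonians $\bar H_d^{+,E}$ and $\bar H_d^{-,E}$. If a discrete Hamiltonian $\bar H_d^{\pm}$ approximates the exact discrete Hamiltonian $\bar H_d^{\pm,E}$ to order $r$, i.e. $$\bar H_d^{+}(\bar q_0,\bar p_1;h)=\bar H_d^{+,E}(\bar q_0,\bar p_1;h)+\mathcal{O}(h^{r+1})$$ in the right case, respectively $$\bar H_d^{-}(\bar q_1,\bar p_0;h)=\bar H_d^{-,E}(\bar q_1,\bar p_0;h)+\mathcal{O}(h^{r+1})$$ in the left case, then the discrete Hamiltonian map $\tilde F_{\bar H_d^{\pm}}:(\bar q_k,\bar p_k)\mapsto(\bar q_{k+1},\bar p_{k+1})$, viewed as a one-step method for Hamilton's equations of $\bar H$, is order $r$ accurate.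
   Context: Here $q,p\in\mathbb{R}^n$. The Hamiltonian $H$ is nondegenerate if $\det\big(\frac{\partial^2H}{\partial p^2}\big)\neq0$. The monitor function $g$ prescribes a time transformation $t\mapsto\tau$ via $\frac{dt}{d\tau}=g(q,p)$. Extended phase space. $\bar q=(q,q^t)$ and $\bar p=(p,p^t)$ in $\mathbb{R}^{n+1}$, where $q^t=t$ is physical time and $p^t$ is its conjugate momentum, chosen as $p^t=-H(q(0),p(0))$. Dots denote derivatives in the fictive time $\tau$, and $h$ is the step in $\tau$. Hamilton's equations of $\bar H$ are $\dot{\bar q}=\frac{\partial\bar H}{\partial\bar p}$, $\dot{\bar p}=-\frac{\partial\bar H}{\partial\bar q}$. Exact discrete Hamiltonians. $$\bar H_d^{+,E}(\bar q_0,\bar p_1;h)=\bar p_1^\top\bar q_1-\int_0^h\big(\bar p(\tau)^\top\dot{\bar q}(\tau)-\bar H(\bar q(\tau),\bar p(\tau))\big)d\tau,$$ where $(\bar q,\bar p)$ solves Hamilton's equations of $\bar H$ with $\bar q(0)=\bar q_0$, $\bar p(h)=\bar p_1$, and $\bar q_1=\bar q(h)$; $$\bar H_d^{-,E}(\bar q_1,\bar p_0;h)=-\bar p_0^\top\bar q_0-\int_0^h\big(\bar p(\tau)^\top\dot{\bar q}(\tau)-\bar H(\bar q(\tau),\bar p(\tau))\big)d\tau,$$ where $(\bar q,\bar p)$ solves Hamilton's equations of $\bar H$ with $\bar q(h)=\bar q_1$, $\bar p(0)=\bar p_0$, and $\bar q_0=\bar q(0)$. These functions are assumed well defined and sufficiently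 smooth for small $h$ on the region considered. Discrete Hamiltonian maps. $\tilde F_{\bar H_d^+}:(\bar q_0,\bar p_0)\mapsto(\bar q_1,\bar p_1)$ is defined implicitly by $\bar p_0=D_1\bar H_d^+(\bar q_0,\bar p_1)$, $\bar q_1=D_2\bar H_d^+(\bar q_0,\bar p_1)$, and $\tilde F_{\bar H_d^-}$ by $\bar p_1=-D_1\bar H_d^-(\bar q_1,\bar p_0)$, $\bar q_0=-D_2\bar H_d^-(\bar q_1,\bar p_0)$, for small $h$ (near the identity), where $D_i$ is the partial derivative in the $i$-th argument. Conventions. An approximation of discrete Hamiltonians to order $r$ means that the difference is $h^{r+1}e$, where $e$ is a sufficiently smooth function of the boundary variables and $h$ (at least $C^2$ in the boundary variables) whose derivatives in the boundary variables are bounded on compact sets uniformly for small $h$. A one-step method is order $r$ accurate if it differs from the exact time-$h$ flow map by $\mathcal{O}(h^{r+1})$. *)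

theory Defs
  imports "HOL-Analysis.Analysis"
begin

(* On an open S this is the usual class C^k.  The derivative is taken within S so that the
   definition also expresses smoothness up to the face h = 0 of a set B \<times> {0..<\<epsilon>}. *)
primrec Ck_on ::
  "nat \<Rightarrow> ('a::real_normed_vector \<Rightarrow> 'b::real_normed_vector) \<Rightarrow> 'a set \<Rightarrow> bool" where
  "Ck_on 0 f S \<longleftrightarrow> continuous_on S f"
| "Ck_on (Suc k) f S \<longleftrightarrow>
     (\<exists>f'. (\<forall>x\<in>S. (f has_derivative f' x) (at x within S)) \<and> (\<forall>v. Ck_on k (\<lambda>x. f' x v) S))"

definition grad :: "('a::real_inner \<Rightarrow> real) \<Rightarrow> 'a \<Rightarrow> 'a" where
  "grad f x = (THE D. GDERIV f x :> D)"

definition hessian :: "(real^'n::finite \<Rightarrow> real) \<Rightarrow> real^'n \<Rightarrow> real^'n^'n" where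
  "hessian f x = jacobian (grad f) (at x)"

definition outer :: "real^'n::finite \<Rightarrow> real^'n \<Rightarrow> real^'n^'n" where
  "outer a b = (\<chi> i j. a $ i * b $ j)"

type_synonym 'n phase = "(real^'n) \<times> (real^'n)"

text \<open>The extended configuration \<open>(q, q\<^sup>t)\<close> and the extended momentum \<open>(p, p\<^sup>t)\<close>
  live in \<open>R\<^sup>n \<times> R\<close>. The type below serves both for points of the
  extended phase space and for pairs of boundary data (a configuration and a momentum).\<close>
type_synonym 'n ext = "(real^'n) \<times> real"
type_synonym 'n ext_phase = "'n ext \<times> 'n ext"

definition grad_q :: "('a::real_inner \<times> 'b::real_inner \<Rightarrow> real) \<Rightarrow> 'a \<times> 'b \<Rightarrow> 'a" where
  "grad_q f z = grad (\<lambda>q. f (q, snd z)) (fst z)"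

definition grad_p :: "('a::real_inner \<times> 'b::real_inner \<Rightarrow> real) \<Rightarrow> 'a \<times> 'b \<Rightarrow> 'b" where
  "grad_p f z = grad (\<lambda>p. f (fst z, p)) (snd z)"

definition hess_pp :: "('n::finite phase \<Rightarrow> real) \<Rightarrow> 'n phase \<Rightarrow> real^'n^'n" where
  "hess_pp H z = hessian (\<lambda>p. H (fst z, p)) (snd z)"

definition nondegenerate_on :: "'n::finite phase set \<Rightarrow> ('n phase \<Rightarrow> real) \<Rightarrow> bool" where
  "nondegenerate_on U H \<longleftrightarrow> (\<forall>z\<in>U. det (hess_pp H z) \<noteq> 0)"

definition poincare :: "('n::finite phase \<Rightarrow> real) \<Rightarrow> ('n phase \<Rightarrow> real) \<Rightarrow> 'n ext_phase \<Rightarrow> real" where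
  "poincare H g = (\<lambda>((q, qt), (p, pt)). g (q, p) * (H (q, p) + pt))"

definition extend :: "'n::finite phase set \<Rightarrow> 'n ext_phase set" where
  "extend U = {((q, qt), (p, pt)) | q qt p pt. (q, p) \<in> U}"

definition hamilton_solution ::
  "('n::finite ext_phase \<Rightarrow> real) \<Rightarrow> 'n ext_phase set \<Rightarrow> real \<Rightarrow> (real \<Rightarrow> 'n ext_phase) \<Rightarrow> bool" where
  "hamilton_solution K D h z \<longleftrightarrow>
     (\<forall>\<tau>\<in>{0..h}. z \<tau> \<in> D \<and>
        ((\<lambda>s. fst (z s)) has_vector_derivative grad_p K (z \<tau>)) (at \<tau> within {0..h}) \<and>
        ((\<lambda>s. snd (z s)) has_vector_derivative - grad_q K (z \<tau>)) (at \<tau> within {0..h}))"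

definition flow_rel ::
  "('n::finite ext_phase \<Rightarrow> real) \<Rightarrow> 'n ext_phase set \<Rightarrow> real \<Rightarrow> 'n ext_phase \<Rightarrow> 'n ext_phase \<Rightarrow> bool" where
  "flow_rel K D h z w \<longleftrightarrow> (\<exists>\<zeta>. hamilton_solution K D h \<zeta> \<and> \<zeta> 0 = z \<and> \<zeta> h = w)"

definition action ::
  "('n::finite ext_phase \<Rightarrow> real) \<Rightarrow> real \<Rightarrow> (real \<Rightarrow> 'n ext_phase) \<Rightarrow> real" where
  "action K h z = integral {0..h}
     (\<lambda>\<tau>. snd (z \<tau>) \<bullet> vector_derivative (\<lambda>s. fst (z s)) (at \<tau> within {0..h}) - K (z \<tau>))"

text \<open>Solutions \<open>Z x h\<close> on \<open>[0,h]\<close> of the boundary value problems, for data \<open>x = (q\<^sub>0, p\<^sub>1)\<close>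
  in the right case and \<open>x = (q\<^sub>1, p\<^sub>0)\<close> in the left case. ``For small \<open>h\<close>'' is understood
  locally in \<open>x\<close>. A boundary value problem may have further solutions far away from its data
  even for small \<open>h\<close>; the requirement that \<open>Z y h \<tau>\<close> tends to \<open>x\<close> as \<open>(y, h)\<close> tends to
  \<open>(x, 0)\<close> selects the solution belonging to the flow near the identity.\<close>

definition right_bvp_solutions ::
  "('n::finite ext_phase \<Rightarrow> real) \<Rightarrow> 'n ext_phase set
     \<Rightarrow> ('n ext_phase \<Rightarrow> real \<Rightarrow> real \<Rightarrow> 'n ext_phase) \<Rightarrow> bool" where
  "right_bvp_solutions K D Z \<longleftrightarrow>
     (\<forall>x\<in>D. \<forall>\<eta>>0. \<exists>\<epsilon>>0. \<forall>q0 p1. \<forall>h\<in>{0..<\<epsilon>}. (q0, p1) \<in> ball x \<epsilon> \<longrightarrow>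
        hamilton_solution K D h (Z (q0, p1) h) \<and>
        fst (Z (q0, p1) h 0) = q0 \<and> snd (Z (q0, p1) h h) = p1 \<and>
        (\<forall>\<tau>\<in>{0..h}. dist (Z (q0, p1) h \<tau>) x < \<eta>))"

definition left_bvp_solutions ::
  "('n::finite ext_phase \<Rightarrow> real) \<Rightarrow> 'n ext_phase set
     \<Rightarrow> ('n ext_phase \<Rightarrow> real \<Rightarrow> real \<Rightarrow> 'n ext_phase) \<Rightarrow> bool" where
  "left_bvp_solutions K D Z \<longleftrightarrow>
     (\<forall>x\<in>D. \<forall>\<eta>>0. \<exists>\<epsilon>>0. \<forall>q1 p0. \<forall>h\<in>{0..<\<epsilon>}. (q1, p0) \<in> ball x \<epsilon> \<longrightarrow>
        hamilton_solution K D h (Z (q1, p0) h) \<and>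
        fst (Z (q1, p0) h h) = q1 \<and> snd (Z (q1, p0) h 0) = p0 \<and>
        (\<forall>\<tau>\<in>{0..h}. dist (Z (q1, p0) h \<tau>) x < \<eta>))"

definition exact_right ::
  "('n::finite ext_phase \<Rightarrow> real) \<Rightarrow> ('n ext_phase \<Rightarrow> real \<Rightarrow> real \<Rightarrow> 'n ext_phase)
     \<Rightarrow> 'n ext_phase \<Rightarrow> real \<Rightarrow> real" where
  "exact_right K Z = (\<lambda>(q0, p1) h.
     p1 \<bullet> fst (Z (q0, p1) h h) - action K h (Z (q0, p1) h))"

definition exact_left ::
  "('n::finite ext_phase \<Rightarrow> real) \<Rightarrow> ('n ext_phase \<Rightarrow> real \<Rightarrow> real \<Rightarrow> 'n ext_phase)
     \<Rightarrow> 'n ext_phase \<Rightarrow> real \<Rightarrow> real" where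
  "exact_left K Z = (\<lambda>(q1, p0) h.
     - (p0 \<bullet> fst (Z (q1, p0) h 0)) - action K h (Z (q1, p0) h))"

text \<open>``Sufficiently smooth for small \<open>h\<close>'': locally \<open>C\<^sup>3\<close> in the boundary data and \<open>h\<close>
  jointly, up to \<open>h = 0\<close>, where the right and the left exact discrete Hamiltonian take the
  values \<open>p\<^sub>1 \<bullet> q\<^sub>0\<close> and \<open>- p\<^sub>0 \<bullet> q\<^sub>1\<close>.\<close>
definition smooth_for_small_h ::
  "'n::finite ext_phase set \<Rightarrow> ('n ext_phase \<Rightarrow> real \<Rightarrow> real) \<Rightarrow> bool" where
  "smooth_for_small_h D S \<longleftrightarrow>
     (\<forall>x\<in>D. \<exists>\<epsilon>>0. Ck_on 3 (\<lambda>(y, h). S y h) (ball x \<epsilon> \<times> {0..<\<epsilon>}))"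

text \<open>\<open>S\<^sub>d = S + h\<^bsup>r+1\<^esup> e\<close> with \<open>e\<close> of class \<open>C\<^sup>2\<close> in the boundary data. Local bounds at every
  point of the open region are the same as bounds on its compact subsets.\<close>
definition approximates_to_order ::
  "nat \<Rightarrow> 'n::finite ext_phase set \<Rightarrow> ('n ext_phase \<Rightarrow> real \<Rightarrow> real)
     \<Rightarrow> ('n ext_phase \<Rightarrow> real \<Rightarrow> real) \<Rightarrow> bool" where
  "approximates_to_order r D Sd S \<longleftrightarrow>
     (\<exists>e. \<forall>x\<in>D. \<exists>\<epsilon>>0. \<exists>M. \<forall>h\<in>{0<..<\<epsilon>}.
        Ck_on 2 (\<lambda>y. e y h) (ball x \<epsilon>) \<and>
        (\<forall>y\<in>ball x \<epsilon>.
           Sd y h = S y h + h ^ (r + 1) * e y h \<and>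
           \<bar>e y h\<bar> \<le> M \<and>
           norm (grad (\<lambda>y. e y h) y) \<le> M \<and>
           onorm (frechet_derivative (grad (\<lambda>y. e y h)) (at y)) \<le> M))"

definition right_step ::
  "'n::finite ext_phase set \<Rightarrow> ('n ext_phase \<Rightarrow> real \<Rightarrow> real)
     \<Rightarrow> real \<Rightarrow> 'n ext_phase \<Rightarrow> 'n ext_phase \<Rightarrow> bool" where
  "right_step D S h = (\<lambda>(q0, p0) (q1, p1).
     (q0, p1) \<in> D \<and>
     (GDERIV (\<lambda>q. S (q, p1) h) q0 :> p0) \<and>
     (GDERIV (\<lambda>p. S (q0, p) h) p1 :> q1))"

definition left_step ::
  "'n::finite ext_phase set \<Rightarrow> ('n ext_phase \<Rightarrow> real \<Rightarrow> real)
     \<Rightarrow> real \<Rightarrow> 'n ext_phase \<Rightarrow> 'n ext_phase \<Rightarrow> bool" where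
  "left_step D S h = (\<lambda>(q0, p0) (q1, p1).
     (q1, p0) \<in> D \<and>
     (GDERIV (\<lambda>q. S (q, p0) h) q1 :> - p1) \<and>
     (GDERIV (\<lambda>p. S (q1, p) h) p0 :> - q0))"

text \<open>The map defined implicitly by a step relation near the identity: \<open>F h z\<close> solves the
  implicit equations for small \<open>h\<close>, and \<open>F h\<close> tends to the identity as \<open>h\<close> tends to \<open>0\<close>,
  both locally uniformly on \<open>D\<close>.\<close>
definition near_identity_map ::
  "'n::finite ext_phase set \<Rightarrow> (real \<Rightarrow> 'n ext_phase \<Rightarrow> 'n ext_phase \<Rightarrow> bool)
     \<Rightarrow> (real \<Rightarrow> 'n ext_phase \<Rightarrow> 'n ext_phase) \<Rightarrow> bool" where
  "near_identity_map D R F \<longleftrightarrow>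
     (\<forall>x\<in>D. \<forall>\<eta>>0. \<exists>\<epsilon>>0. \<forall>z\<in>ball x \<epsilon>. \<forall>h\<in>{0<..<\<epsilon>}. R h z (F h z) \<and> dist (F h z) x < \<eta>)"

text \<open>The one-step error is \<open>O(h\<^bsup>r+1\<^esup>)\<close>, locally uniformly on \<open>D\<close>. That the exact time-\<open>h\<close>
  flow map is well defined for small \<open>h\<close> is part of the statement.\<close>
definition order_accurate ::
  "nat \<Rightarrow> ('n::finite ext_phase \<Rightarrow> real) \<Rightarrow> 'n ext_phase set
     \<Rightarrow> (real \<Rightarrow> 'n ext_phase \<Rightarrow> 'n ext_phase) \<Rightarrow> bool" where
  "order_accurate r K D F \<longleftrightarrow>
     (\<forall>x\<in>D. \<exists>C. \<exists>\<epsilon>>0. \<forall>z\<in>ball x \<epsilon>. \<forall>h\<in>{0<..<\<epsilon>}.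
        (\<exists>!w. flow_rel K D h z w) \<and>
        (\<forall>w. flow_rel K D h z w \<longrightarrow> norm (F h z - w) \<le> C * h ^ (r + 1)))"

end

theory Submission
  imports Defs
begin

text \<open>Write \<open>K\<close> for the Poincare transformed Hamiltonian. A monitor function of class \<open>C\<^sup>1\<close> gives
a \<open>K\<close> of class \<open>C\<^sup>1\<close> only, hence a Hamiltonian vector field that is merely continuous, for
which neither uniqueness nor Lipschitz dependence of solutions is available. The missing derivative
comes from the exact discrete Hamiltonian \<open>S\<close>: along the solutions of the boundary value problem
\<open>S(y, h) = S(y, 0) + h K(y) + o(h)\<close>, so \<open>K\<close> is the \<open>h\<close>-derivative of \<open>S\<close> at
\<open>h = 0\<close>, and \<open>S \<in> C\<^sup>3\<close> up to \<open>h = 0\<close> makes \<open>K\<close> of class \<open>C\<^sup>2\<close>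
(\<open>K_locally_C2\<close>). From there on the vector field is locally Lipschitz.

On a time interval that is short compared with the Lipschitz constant, the difference of two
solutions is controlled by the difference of one value of \<open>q\<close> and one value of \<open>p\<close>, taken at
arbitrary times (\<open>two_point_stability\<close>). Initial value problems and both kinds of boundary value
problems are thus treated by one estimate. With it, the first variation of the action has a remainder
quadratic in the boundary data, which gives the classical fact that \<open>S\<close> generates the flow: its
gradient in \<open>(q\<^sub>0, p\<^sub>1)\<close> is \<open>(p\<^sub>0, q\<^sub>1)\<close>, and its gradient in
\<open>(q\<^sub>1, p\<^sub>0)\<close> is \<open>(- p\<^sub>1, - q\<^sub>0)\<close> for the left version
(\<open>bvp_locally_controlled\<close>).

A step of the discrete Hamiltonian map of \<open>S + h\<^bsup>r+1\<^esup> e\<close> with boundary data \<open>y\<close>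
therefore differs from the exact solution with the same boundary data by the components of
\<open>h\<^bsup>r+1\<^esup> \<nabla>e\<close>: one of them perturbs the initial point, the other one the end point
(\<open>local_discrete_step\<close>). Stability of the flow turns this into the one-step error
\<open>O(h\<^bsup>r+1\<^esup>)\<close>. Solvability of the implicit equations, and existence of the exact flow as the
special case \<open>e = 0\<close>, follow from Brouwer's theorem, since the map from boundary data to initial
points is a continuous perturbation of the identity of size \<open>O(h)\<close>.

The right and the left case differ only in the times at which \<open>q\<close> and \<open>p\<close> are prescribed and
in a sign; a Boolean parameter distinguishes them.\<close>

section \<open>Functions of class \<open>C\<^sup>k\<close> and their gradients\<close>

lemma Ck_on_cong:
  assumes "Ck_on k f S" "\<And>x. x \<in> S \<Longrightarrow> f x = g x"
  shows "Ck_on k g S"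
proof (cases k)
  case 0
  then show ?thesis using assms(1) continuous_on_eq[OF _ assms(2)] by simp
next
  case (Suc l)
  then obtain f' where f': "\<forall>x\<in>S. (f has_derivative f' x) (at x within S)"
    "\<forall>v. Ck_on l (\<lambda>x. f' x v) S" using assms(1) by auto
  have "\<forall>x\<in>S. (g has_derivative f' x) (at x within S)"
    using f'(1) assms(2) by (metis has_derivative_transform)
  then show ?thesis using Suc f'(2) by auto
qed

lemma Ck_on_subset: "Ck_on k f S \<Longrightarrow> T \<subseteq> S \<Longrightarrow> Ck_on k f T"
proof (induction k arbitrary: f)
  case 0
  then show ?case by (auto intro: continuous_on_subset)
next
  case (Suc k)
  then obtain f' where f': "\<forall>x\<in>S. (f has_derivative f' x) (at x within S)"
    "\<forall>v. Ck_on k (\<lambda>x. f' x v) S" by auto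
  have "\<forall>x\<in>T. (f has_derivative f' x) (at x within T)"
    using f'(1) Suc.prems(2) by (meson has_derivative_subset subsetD)
  then show ?case using Suc f'(2) by auto
qed

lemma Ck_on_Suc_imp: "Ck_on (Suc k) f S \<Longrightarrow> Ck_on k f S"
proof (induction k arbitrary: f)
  case 0
  then show ?case by (auto intro: has_derivative_continuous_on)
next
  case (Suc k)
  then obtain f' where f': "\<forall>x\<in>S. (f has_derivative f' x) (at x within S)"
    "\<forall>v. Ck_on (Suc k) (\<lambda>x. f' x v) S" by (subst (asm) Ck_on.simps(2)) blast
  then have "\<forall>v. Ck_on k (\<lambda>x. f' x v) S" using Suc.IH by blast
  then show ?case using f'(1) by auto
qed

lemma Ck_on_2_imp_1: "Ck_on 2 f S \<Longrightarrow> Ck_on 1 f S"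
  using Ck_on_Suc_imp[of 1 f S] by (simp only: Suc_1)

text \<open>Restriction to a face \<open>b\<close> of a product; it carries one-sided smoothness of \<open>S\<close> up to
\<open>h = 0\<close> over to smoothness in the boundary data at \<open>h = 0\<close>.\<close>

lemma Ck_on_slice:
  "Ck_on k f (A \<times> B) \<Longrightarrow> b \<in> B \<Longrightarrow> Ck_on k (\<lambda>y. f (y, b)) A"
proof (induction k arbitrary: f)
  case 0
  then have "continuous_on (A \<times> B) f" by simp
  then have "continuous_on A (\<lambda>y. f (y, b))"
    by (rule continuous_on_compose2) (auto intro!: continuous_intros simp: 0)
  then show ?case by simp
next
  case (Suc k)
  then obtain f' where f': "\<forall>x\<in>A \<times> B. (f has_derivative f' x) (at x within A \<times> B)"
    "\<forall>v. Ck_on k (\<lambda>x. f' x v) (A \<times> B)" by auto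
  have "((\<lambda>y. f (y, b)) has_derivative (\<lambda>v. f' (y, b) (v, 0))) (at y within A)" if "y \<in> A" for y
    by (rule has_derivative_in_compose2[of "A \<times> B" f f' "\<lambda>y. (y, b)" A y "\<lambda>v. (v, 0)"])
       (use f'(1) that Suc.prems(2) in \<open>auto intro!: derivative_eq_intros\<close>)
  moreover have "\<forall>v. Ck_on k (\<lambda>y. f' (y, b) (v, 0)) A"
    using Suc.IH[of "\<lambda>x. f' x (v, 0)" for v] f'(2) Suc.prems(2) by blast
  ultimately show ?case
    unfolding Ck_on.simps(2) by (intro exI[of _ "\<lambda>y v. f' (y, b) (v, 0)"]) blast
qed

lemma grad_eqI:
  assumes "GDERIV f x :> D"
  shows "grad f x = D"
  unfolding grad_def
proof (rule the_equality)
  fix E assume "GDERIV f x :> E"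
  then have "(\<lambda>h. h \<bullet> E) = (\<lambda>h. h \<bullet> D)"
    using assms has_derivative_unique unfolding gderiv_def by blast
  then show "E = D" by (metis vector_eq_ldot)
qed (rule assms)

text \<open>The Riesz representative in coordinates. The derivative of a \<open>C\<^sup>k\<close> function is given
direction by direction, and the sum over a basis shows that the gradient inherits the smoothness of
these directional derivatives.\<close>

lemma linear_functional_eq_inner:
  fixes l :: "'a::euclidean_space \<Rightarrow> real"
  assumes "linear l"
  shows "l v = v \<bullet> (\<Sum>b\<in>Basis. l b *\<^sub>R b)"
proof -
  have "l v = l (\<Sum>b\<in>Basis. (v \<bullet> b) *\<^sub>R b)" by (simp add: euclidean_representation)
  also have "\<dots> = (\<Sum>b\<in>Basis. (v \<bullet> b) * l b)"
    using assms by (simp add: linear_sum linear_scale)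
  finally show ?thesis by (simp add: inner_sum_right mult.commute)
qed

lemma Ck_on_Suc_grad:
  fixes f :: "'a::euclidean_space \<Rightarrow> real"
  assumes "Ck_on (Suc k) f S" "open S"
  shows "\<And>x. x \<in> S \<Longrightarrow> GDERIV f x :> grad f x"
    and "\<And>v. Ck_on k (\<lambda>x. grad f x \<bullet> v) S"
proof -
  obtain f' where f': "\<And>x. x\<in>S \<Longrightarrow> (f has_derivative f' x) (at x)"
    and cont: "\<And>v. Ck_on k (\<lambda>x. f' x v) S"
    using assms(1) by (auto simp: at_within_open[OF _ assms(2)])
  define G where "G x = (\<Sum>b\<in>Basis. f' x b *\<^sub>R b)" for x
  have fG: "f' x v = v \<bullet> G x" if "x \<in> S" for x v
    unfolding G_def using has_derivative_linear[OF f'[OF that]] by (rule linear_functional_eq_inner)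
  have G: "GDERIV f x :> G x" if "x \<in> S" for x
  proof -
    have "f' x = (\<lambda>v. v \<bullet> G x)" using fG[OF that] by blast
    then show ?thesis using f'[OF that] unfolding gderiv_def by (simp only:)
  qed
  show "GDERIV f x :> grad f x" if "x \<in> S" for x
    using G[OF that] unfolding grad_eqI[OF G[OF that]] .
  have *: "f' x v = grad f x \<bullet> v" if "x \<in> S" for x v
    using fG[OF that, of v] grad_eqI[OF G[OF that]] by (simp only: inner_commute)
  show "Ck_on k (\<lambda>x. grad f x \<bullet> v) S" for v
    by (rule Ck_on_cong[OF cont *])
qed

lemma continuous_on_grad:
  fixes f :: "'a::euclidean_space \<Rightarrow> real"
  assumes "Ck_on 1 f S" "open S"
  shows "continuous_on S (grad f)"
proof -
  have "continuous_on S (\<lambda>x. grad f x \<bullet> v)" for v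
    using Ck_on_Suc_grad(2)[of 0 f S v] assms by simp
  then show ?thesis using continuous_on_componentwise by blast
qed

text \<open>Each component of the gradient is \<open>C\<^sup>1\<close>, so its gradient is bounded on a compact ball and the
mean value inequality applies; the Lipschitz constants of the components add up.\<close>

lemma Ck_on_2_grad_lipschitz:
  fixes f :: "'a::euclidean_space \<Rightarrow> real"
  assumes "Ck_on 2 f S" "open S" "x \<in> S"
  shows "\<exists>\<delta>>0. \<exists>L. ball x \<delta> \<subseteq> S \<and> L-lipschitz_on (ball x \<delta>) (grad f)"
proof -
  obtain \<delta> where \<delta>: "\<delta> > 0" "cball x \<delta> \<subseteq> S" using open_contains_cball_eq[OF assms(2)] assms(3) by blast
  have "Ck_on (Suc (Suc 0)) f S" using assms(1) by (simp only: numeral_2_eq_2)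
  then have C1: "Ck_on (Suc 0) (\<lambda>x. grad f x \<bullet> b) S" for b
    using Ck_on_Suc_grad(2) assms(2) by blast
  have "\<exists>L. L-lipschitz_on (ball x \<delta>) (\<lambda>x. grad f x \<bullet> b)" for b
  proof -
    let ?g = "\<lambda>x. grad f x \<bullet> b"
    have "continuous_on (cball x \<delta>) (grad ?g)"
      by (rule continuous_on_subset[OF continuous_on_grad[OF C1[folded One_nat_def] assms(2)] \<delta>(2)])
    then have "bounded (grad ?g ` cball x \<delta>)"
      by (intro compact_imp_bounded compact_continuous_image compact_cball)
    then obtain L where L: "L > 0" "\<And>y. y \<in> cball x \<delta> \<Longrightarrow> norm (grad ?g y) \<le> L"
      unfolding bounded_pos by auto
    have "norm (?g y - ?g z) \<le> L * norm (y - z)" if "y \<in> ball x \<delta>" "z \<in> ball x \<delta>" for y z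
    proof (rule differentiable_bound[OF convex_ball _ _ that])
      fix u assume u: "u \<in> ball x \<delta>"
      then have "u \<in> S" using \<delta>(2) by auto
      then have "GDERIV ?g u :> grad ?g u" by (rule Ck_on_Suc_grad(1)[OF C1 assms(2)])
      then show "(?g has_derivative (\<lambda>v. v \<bullet> grad ?g u)) (at u within ball x \<delta>)"
        unfolding gderiv_def by (rule has_derivative_at_withinI)
      show "onorm (\<lambda>v. v \<bullet> grad ?g u) \<le> L"
      proof (rule onorm_bound)
        fix v
        have "norm (v \<bullet> grad ?g u) \<le> norm v * norm (grad ?g u)"
          by (simp add: Cauchy_Schwarz_ineq2)
        also have "\<dots> \<le> norm v * L" using L(2)[of u] u by (intro mult_left_mono) auto
        finally show "norm (v \<bullet> grad ?g u) \<le> L * norm v" by (simp add: mult.commute)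
      qed (use L in simp)
    qed
    then have "L-lipschitz_on (ball x \<delta>) ?g"
      using L(1) by (intro lipschitz_onI) (auto simp: dist_norm)
    then show ?thesis by blast
  qed
  then obtain L where L: "\<And>b. (L b)-lipschitz_on (ball x \<delta>) (\<lambda>x. grad f x \<bullet> b)" by metis
  have "(\<Sum>b\<in>Basis. L b)-lipschitz_on (ball x \<delta>) (grad f)"
  proof (rule lipschitz_onI)
    fix y z assume yz: "y \<in> ball x \<delta>" "z \<in> ball x \<delta>"
    have "dist (grad f y) (grad f z) \<le> (\<Sum>b\<in>Basis. \<bar>(grad f y - grad f z) \<bullet> b\<bar>)"
      unfolding dist_norm by (rule norm_le_l1)
    also have "\<dots> \<le> (\<Sum>b\<in>Basis. L b * dist y z)"
      using lipschitz_onD[OF L yz] by (intro sum_mono) (simp add: dist_norm inner_diff_left)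
    finally show "dist (grad f y) (grad f z) \<le> (\<Sum>b\<in>Basis. L b) * dist y z"
      by (simp add: sum_distrib_right)
  qed (intro sum_nonneg lipschitz_on_nonneg[OF L])
  moreover have "ball x \<delta> \<subseteq> S" using \<delta>(2) ball_subset_cball by blast
  ultimately show ?thesis using \<delta>(1) by blast
qed

lemma GDERIV_fst_partial: "GDERIV f (a, b) :> G \<Longrightarrow> GDERIV (\<lambda>q. f (q, b)) a :> fst G"
  unfolding gderiv_def
  by (drule has_derivative_compose[of "\<lambda>q. (q, b)" "\<lambda>v. (v, 0)" a UNIV f, rotated])
     (auto intro!: derivative_eq_intros simp: inner_prod_def)

lemma GDERIV_snd_partial: "GDERIV f (a, b) :> G \<Longrightarrow> GDERIV (\<lambda>p. f (a, p)) b :> snd G"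
  unfolding gderiv_def
  by (drule has_derivative_compose[of "\<lambda>p. (a, p)" "\<lambda>v. (0, v)" b UNIV f, rotated])
     (auto intro!: derivative_eq_intros simp: inner_prod_def)

lemma grad_q_eq: "GDERIV f z :> G \<Longrightarrow> grad_q f z = fst G"
  unfolding grad_q_def by (cases z) (auto intro!: grad_eqI dest: GDERIV_fst_partial)

lemma grad_p_eq: "GDERIV f z :> G \<Longrightarrow> grad_p f z = snd G"
  unfolding grad_p_def by (cases z) (auto intro!: grad_eqI dest: GDERIV_snd_partial)

lemma Ck_on_1_poincare:
  assumes "open U" "Ck_on 1 H U" "Ck_on 1 g U"
  shows "Ck_on 1 (poincare H g) (extend U)"
proof -
  obtain H' where H': "\<And>x. x\<in>U \<Longrightarrow> (H has_derivative H' x) (at x)"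
    and cH': "\<And>v. continuous_on U (\<lambda>x. H' x v)"
    using assms(2) by (auto simp: at_within_open[OF _ assms(1)])
  obtain g' where g': "\<And>x. x\<in>U \<Longrightarrow> (g has_derivative g' x) (at x)"
    and cg': "\<And>v. continuous_on U (\<lambda>x. g' x v)"
    using assms(3) by (auto simp: at_within_open[OF _ assms(1)])
  define \<pi> where "\<pi> z = (fst (fst z), fst (snd z))" for z :: "'a ext_phase"
  have cH: "continuous_on U H" and cg: "continuous_on U g"
    using H' g' by (meson continuous_at_imp_continuous_on has_derivative_continuous)+
  have K: "poincare H g = (\<lambda>z. g (\<pi> z) * (H (\<pi> z) + snd (snd z)))"
    by (auto simp: poincare_def \<pi>_def fun_eq_iff)
  have \<pi>U: "\<pi> z \<in> U" if "z \<in> extend U" for z using that by (auto simp: extend_def \<pi>_def)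
  have \<pi>d: "(\<pi> has_derivative \<pi>) (at z within A)" for z A
    unfolding \<pi>_def
    by (intro has_derivative_Pair has_derivative_fst has_derivative_snd has_derivative_ident)
  have c\<pi>: "continuous_on (extend U) (\<lambda>z. u (\<pi> z))" if "continuous_on U u" for u :: "'a phase \<Rightarrow> real"
    by (rule continuous_on_compose2[OF that]) (use \<pi>U in \<open>auto simp: \<pi>_def intro!: continuous_intros\<close>)
  have "(poincare H g has_derivative (\<lambda>v. g (\<pi> z) * (H' (\<pi> z) (\<pi> v) + snd (snd v))
      + g' (\<pi> z) (\<pi> v) * (H (\<pi> z) + snd (snd z)))) (at z within extend U)"
    if z: "z \<in> extend U" for z
    unfolding K
    by (intro has_derivative_mult has_derivative_add has_derivative_snd has_derivative_ident
        has_derivative_compose[OF \<pi>d H'[OF \<pi>U[OF z]]] has_derivative_compose[OF \<pi>d g'[OF \<pi>U[OF z]]])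
  moreover have "continuous_on (extend U) (\<lambda>z. g (\<pi> z) * (H' (\<pi> z) (\<pi> v) + snd (snd v))
      + g' (\<pi> z) (\<pi> v) * (H (\<pi> z) + snd (snd z)))" for v
    by (intro continuous_intros c\<pi> cH cg cH' cg')
  ultimately show ?thesis
    unfolding One_nat_def Ck_on.simps
    by (intro exI[of _ "\<lambda>z v. g (\<pi> z) * (H' (\<pi> z) (\<pi> v) + snd (snd v))
      + g' (\<pi> z) (\<pi> v) * (H (\<pi> z) + snd (snd z))"] conjI ballI allI)
qed

section \<open>Elementary estimates\<close>

lemma vector_derivative_bound:
  fixes f :: "real \<Rightarrow> 'a::real_normed_vector"
  assumes "convex S" and f: "\<And>t. t \<in> S \<Longrightarrow> (f has_vector_derivative f' t) (at t within S)"
    and B: "\<And>t. t \<in> S \<Longrightarrow> norm (f' t) \<le> B" and "x \<in> S" "y \<in> S"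
  shows "norm (f x - f y) \<le> B * \<bar>x - y\<bar>"
proof -
  have "norm (f x - f y) \<le> B * norm (x - y)"
  proof (rule differentiable_bound[OF assms(1) _ _ assms(4,5)])
    show "(f has_derivative (\<lambda>h. h *\<^sub>R f' t)) (at t within S)" if "t \<in> S" for t
      using f[OF that] by (simp only: has_vector_derivative_def)
    show "onorm (\<lambda>h. h *\<^sub>R f' t) \<le> B" if "t \<in> S" for t
      by (rule onorm_le) (use mult_right_mono[OF B[OF that] abs_ge_zero] in \<open>simp add: mult.commute\<close>)
  qed
  then show ?thesis by simp
qed

text \<open>The mean value inequality for \<open>z \<mapsto> K z - z \<bullet> grad K u\<close> on the segment from \<open>u\<close> to
\<open>v\<close>, where the gradient of this function is at most \<open>L\<close> times the length of the segment.\<close>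

lemma quadratic_remainder:
  fixes K :: "'a::euclidean_space \<Rightarrow> real"
  assumes "convex B" and K: "\<And>y. y \<in> B \<Longrightarrow> GDERIV K y :> grad K y"
    and L: "L-lipschitz_on B (grad K)" and uv: "u \<in> B" "v \<in> B"
  shows "\<bar>K v - K u - (v - u) \<bullet> grad K u\<bar> \<le> L * (norm (v - u))\<^sup>2"
proof -
  let ?f = "\<lambda>z. K z - z \<bullet> grad K u"
  have seg: "closed_segment u v \<subseteq> B" using assms by (simp add: closed_segment_subset)
  have "norm (?f v - ?f u) \<le> (L * norm (v - u)) * norm (v - u)"
  proof (rule differentiable_bound[OF convex_closed_segment[of u v]])
    fix z assume z: "z \<in> closed_segment u v"
    then have zB: "z \<in> B" using seg by blast
    show "(?f has_derivative (\<lambda>w. w \<bullet> grad K z - w \<bullet> grad K u)) (at z within closed_segment u v)"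
      using has_derivative_at_withinI[OF K[OF zB, unfolded gderiv_def]]
      by (intro has_derivative_diff has_derivative_inner_left has_derivative_ident)
    have "norm (grad K z - grad K u) \<le> L * norm (z - u)"
      using lipschitz_on_normD[OF L zB uv(1)] .
    also have "\<dots> \<le> L * norm (v - u)"
      using dist_in_closed_segment(1)[OF z] lipschitz_on_nonneg[OF L]
      by (intro mult_left_mono) (auto simp: dist_norm norm_minus_commute)
    finally have "norm (grad K z - grad K u) \<le> L * norm (v - u)" .
    then have "norm (w \<bullet> grad K z - w \<bullet> grad K u) \<le> (L * norm (v - u)) * norm w" for w
      using Cauchy_Schwarz_ineq2[of w "grad K z - grad K u"]
        mult_left_mono[of "norm (grad K z - grad K u)" "L * norm (v - u)" "norm w"]
      by (simp add: inner_diff_right mult.commute)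
    then show "onorm (\<lambda>w. w \<bullet> grad K z - w \<bullet> grad K u) \<le> L * norm (v - u)"
      by (intro onorm_le)
  qed auto
  then show ?thesis by (simp add: inner_diff_left power2_eq_square algebra_simps)
qed

lemma GDERIV_of_quadratic_bound:
  fixes f :: "'a::real_inner \<Rightarrow> real"
  assumes "\<epsilon> > 0"
    and "\<And>y. y \<in> ball x \<epsilon> \<Longrightarrow> \<bar>f y - f x - (y - x) \<bullet> G\<bar> \<le> C * (norm (y - x))\<^sup>2"
  shows "GDERIV f x :> G"
  unfolding gderiv_def has_derivative_at_alt
proof (intro conjI allI impI)
  show "bounded_linear (\<lambda>h. h \<bullet> G)" by (rule bounded_linear_inner_left)
  fix e :: real assume e: "e > 0"
  let ?d = "min \<epsilon> (e / (\<bar>C\<bar> + 1))"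
  have "norm (f y - f x - (y - x) \<bullet> G) \<le> e * norm (y - x)" if y: "norm (y - x) < ?d" for y
  proof -
    have "norm (f y - f x - (y - x) \<bullet> G) \<le> C * (norm (y - x))\<^sup>2"
      using assms(2)[of y] y by (simp add: dist_norm norm_minus_commute)
    also have "\<dots> \<le> ((\<bar>C\<bar> + 1) * norm (y - x)) * norm (y - x)"
      by (simp add: power2_eq_square mult.assoc mult_right_mono)
    also have "\<dots> \<le> e * norm (y - x)"
      using y by (intro mult_right_mono) (auto simp: field_simps)
    finally show ?thesis .
  qed
  then show "\<exists>d>0. \<forall>y. norm (y - x) < d \<longrightarrow> norm (f y - f x - (y - x) \<bullet> G) \<le> e * norm (y - x)"
    using assms(1) e by (intro exI[of _ ?d]) auto
qed

section \<open>Solutions of the Hamiltonian system\<close>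

text \<open>With \<open>N\<close> the maximum of \<open>norm \<circ> \<delta>\<close>, each component of \<open>\<delta>\<close> changes by at most
\<open>(b - a) L N \<le> N / 4\<close>, hence \<open>N\<close> is at most the given data plus \<open>N / 2\<close>. The times
\<open>s\<close> and \<open>t\<close> are independent: \<open>s = t\<close> is the initial value problem, the end points are the
two boundary value problems.\<close>

lemma two_point_stability:
  fixes \<delta> :: "real \<Rightarrow> 'a::real_normed_vector \<times> 'b::real_normed_vector"
  assumes d1: "\<And>\<tau>. \<tau> \<in> {a..b} \<Longrightarrow> ((\<lambda>s. fst (\<delta> s)) has_vector_derivative d1 \<tau>) (at \<tau> within {a..b})"
    and d2: "\<And>\<tau>. \<tau> \<in> {a..b} \<Longrightarrow> ((\<lambda>s. snd (\<delta> s)) has_vector_derivative d2 \<tau>) (at \<tau> within {a..b})"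
    and b1: "\<And>\<tau>. \<tau> \<in> {a..b} \<Longrightarrow> norm (d1 \<tau>) \<le> L * norm (\<delta> \<tau>)"
    and b2: "\<And>\<tau>. \<tau> \<in> {a..b} \<Longrightarrow> norm (d2 \<tau>) \<le> L * norm (\<delta> \<tau>)"
    and L: "L \<ge> 0" "(b - a) * L \<le> 1/4"
    and st: "s \<in> {a..b}" "t \<in> {a..b}" "\<tau> \<in> {a..b}"
  shows "norm (\<delta> \<tau>) \<le> 2 * (norm (fst (\<delta> s)) + norm (snd (\<delta> t)))"
proof -
  have "continuous_on {a..b} (\<lambda>s. (fst (\<delta> s), snd (\<delta> s)))"
    using d1 d2 by (intro continuous_on_Pair)
      (meson continuous_on_eq_continuous_within has_vector_derivative_continuous)+
  then have "continuous_on {a..b} (\<lambda>s. norm (\<delta> s))" by (intro continuous_on_norm) simp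
  then obtain m where m: "m \<in> {a..b}" "\<And>s. s \<in> {a..b} \<Longrightarrow> norm (\<delta> s) \<le> norm (\<delta> m)"
    using continuous_attains_sup[of "{a..b}"] st(1) by (metis compact_Icc empty_iff)
  define N where "N = norm (\<delta> m)"
  have bd: "L * norm (\<delta> s) \<le> L * N" if "s \<in> {a..b}" for s
    unfolding N_def using m(2)[OF that] L(1) by (intro mult_left_mono)
  have LN: "L * N * \<bar>m - u\<bar> \<le> N / 4" if "u \<in> {a..b}" for u
  proof -
    have "L * N * \<bar>m - u\<bar> \<le> L * N * (b - a)"
      using that m(1) L(1) by (intro mult_left_mono) (auto simp: N_def)
    also have "\<dots> = ((b - a) * L) * N" by simp
    also have "\<dots> \<le> 1/4 * N" using L(2) by (intro mult_right_mono) (auto simp: N_def)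
    finally show ?thesis by simp
  qed
  have "norm (fst (\<delta> m) - fst (\<delta> s)) \<le> L * N * \<bar>m - s\<bar>"
    by (rule vector_derivative_bound[OF convex_closed_interval d1])
       (use b1 bd m(1) st in \<open>auto intro: order_trans\<close>)
  then have 1: "norm (fst (\<delta> m)) \<le> norm (fst (\<delta> s)) + N / 4"
    using LN[OF st(1)] norm_triangle_ineq2[of "fst (\<delta> m)" "fst (\<delta> s)"] by linarith
  have "norm (snd (\<delta> m) - snd (\<delta> t)) \<le> L * N * \<bar>m - t\<bar>"
    by (rule vector_derivative_bound[OF convex_closed_interval d2])
       (use b2 bd m(1) st in \<open>auto intro: order_trans\<close>)
  then have 2: "norm (snd (\<delta> m)) \<le> norm (snd (\<delta> t)) + N / 4"
    using LN[OF st(2)] norm_triangle_ineq2[of "snd (\<delta> m)" "snd (\<delta> t)"] by linarith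
  have "N \<le> norm (fst (\<delta> m)) + norm (snd (\<delta> m))"
    unfolding N_def using norm_Pair_le[of "fst (\<delta> m)" "snd (\<delta> m)"] by simp
  then have "N \<le> 2 * (norm (fst (\<delta> s)) + norm (snd (\<delta> t)))" using 1 2 by simp
  then show ?thesis using m(2)[OF st(3)] by (simp add: N_def)
qed

lemma hamilton_solutionD:
  assumes "hamilton_solution K D h \<zeta>" and K: "\<And>y. y \<in> D \<Longrightarrow> GDERIV K y :> grad K y"
    and "\<tau> \<in> {0..h}"
  shows "\<zeta> \<tau> \<in> D"
    and "((\<lambda>s. fst (\<zeta> s)) has_vector_derivative snd (grad K (\<zeta> \<tau>))) (at \<tau> within {0..h})"
    and "((\<lambda>s. snd (\<zeta> s)) has_vector_derivative - fst (grad K (\<zeta> \<tau>))) (at \<tau> within {0..h})"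
proof -
  show D: "\<zeta> \<tau> \<in> D" using assms unfolding hamilton_solution_def by blast
  show "((\<lambda>s. fst (\<zeta> s)) has_vector_derivative snd (grad K (\<zeta> \<tau>))) (at \<tau> within {0..h})"
    "((\<lambda>s. snd (\<zeta> s)) has_vector_derivative - fst (grad K (\<zeta> \<tau>))) (at \<tau> within {0..h})"
    using assms unfolding hamilton_solution_def grad_p_eq[OF K[OF D], symmetric]
      grad_q_eq[OF K[OF D], symmetric] by blast+
qed

lemma hamilton_solution_continuous:
  assumes "hamilton_solution K D h \<zeta>"
  shows "continuous_on {0..h} \<zeta>"
proof -
  have "continuous_on {0..h} (\<lambda>s. (fst (\<zeta> s), snd (\<zeta> s)))"
    using assms unfolding hamilton_solution_def by (intro continuous_on_Pair)
      (meson continuous_on_eq_continuous_within has_vector_derivative_continuous)+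
  then show ?thesis by simp
qed

lemma norm_fst_snd_le:
  "norm (fst z) \<le> norm z" "norm (snd z) \<le> norm z" "norm z \<le> norm (fst z) + norm (snd z)"
  by (cases z, simp add: norm_fst_le norm_snd_le norm_Pair_le)+

lemma hamilton_solutions_stable:
  assumes sol: "hamilton_solution K D h \<zeta>\<^sub>1" "hamilton_solution K D h \<zeta>\<^sub>2"
    and K: "\<And>y. y \<in> D \<Longrightarrow> GDERIV K y :> grad K y"
    and L: "L-lipschitz_on B (grad K)" "(b - a) * L \<le> 1/4"
    and ab: "{a..b} \<subseteq> {0..h}"
    and B: "\<And>\<tau>. \<tau> \<in> {a..b} \<Longrightarrow> \<zeta>\<^sub>1 \<tau> \<in> B" "\<And>\<tau>. \<tau> \<in> {a..b} \<Longrightarrow> \<zeta>\<^sub>2 \<tau> \<in> B"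
    and st: "s \<in> {a..b}" "t \<in> {a..b}" "\<tau> \<in> {a..b}"
  shows "norm (\<zeta>\<^sub>1 \<tau> - \<zeta>\<^sub>2 \<tau>)
    \<le> 2 * (norm (fst (\<zeta>\<^sub>1 s) - fst (\<zeta>\<^sub>2 s)) + norm (snd (\<zeta>\<^sub>1 t) - snd (\<zeta>\<^sub>2 t)))"
proof -
  let ?g = "\<lambda>u. grad K (\<zeta>\<^sub>1 u) - grad K (\<zeta>\<^sub>2 u)"
  have g: "norm (?g u) \<le> L * norm (\<zeta>\<^sub>1 u - \<zeta>\<^sub>2 u)" if "u \<in> {a..b}" for u
    using lipschitz_on_normD[OF L(1) B(1)[OF that] B(2)[OF that]] .
  have "norm (\<zeta>\<^sub>1 \<tau> - \<zeta>\<^sub>2 \<tau>) \<le> 2 * (norm (fst (\<zeta>\<^sub>1 s - \<zeta>\<^sub>2 s)) + norm (snd (\<zeta>\<^sub>1 t - \<zeta>\<^sub>2 t)))"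
  proof (rule two_point_stability[OF _ _ _ _ lipschitz_on_nonneg[OF L(1)] L(2) st])
    fix u assume u: "u \<in> {a..b}"
    then have u': "u \<in> {0..h}" using ab by blast
    show "((\<lambda>s. fst (\<zeta>\<^sub>1 s - \<zeta>\<^sub>2 s)) has_vector_derivative snd (?g u)) (at u within {a..b})"
      unfolding fst_diff snd_diff
      by (intro has_vector_derivative_diff has_vector_derivative_within_subset[OF _ ab]
          hamilton_solutionD(2)[OF sol(1) K u'] hamilton_solutionD(2)[OF sol(2) K u'])
    have "((\<lambda>s. snd (\<zeta>\<^sub>1 s - \<zeta>\<^sub>2 s)) has_vector_derivative
       - fst (grad K (\<zeta>\<^sub>1 u)) - - fst (grad K (\<zeta>\<^sub>2 u))) (at u within {a..b})"
      unfolding fst_diff snd_diff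
      by (intro has_vector_derivative_diff has_vector_derivative_within_subset[OF _ ab]
          hamilton_solutionD(3)[OF sol(1) K u'] hamilton_solutionD(3)[OF sol(2) K u'])
    then show "((\<lambda>s. snd (\<zeta>\<^sub>1 s - \<zeta>\<^sub>2 s)) has_vector_derivative - fst (?g u)) (at u within {a..b})"
      by simp
    show "norm (snd (?g u)) \<le> L * norm (\<zeta>\<^sub>1 u - \<zeta>\<^sub>2 u)"
      using g[OF u] norm_fst_snd_le(2)[of "?g u"] by linarith
    show "norm (- fst (?g u)) \<le> L * norm (\<zeta>\<^sub>1 u - \<zeta>\<^sub>2 u)"
      using g[OF u] norm_fst_snd_le(1)[of "?g u"] norm_minus_cancel[of "fst (?g u)"] by linarith
  qed
  then show ?thesis by simp
qed

text \<open>The second solution may leave \<open>B\<close>, where the Lipschitz estimate holds, so the estimate cannot be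
applied to the whole interval at once. The set of times at which the solutions agree is closed, and
it is open because near such a time both solutions stay in \<open>B\<close>.\<close>

lemma hamilton_solution_unique:
  assumes sol: "hamilton_solution K D h \<zeta>\<^sub>1" "hamilton_solution K D h \<zeta>\<^sub>2"
    and K: "\<And>y. y \<in> D \<Longrightarrow> GDERIV K y :> grad K y"
    and L: "L-lipschitz_on B (grad K)" "h * L \<le> 1/4" and "open B"
    and B: "\<And>\<tau>. \<tau> \<in> {0..h} \<Longrightarrow> \<zeta>\<^sub>1 \<tau> \<in> B"
    and eq0: "\<zeta>\<^sub>1 0 = \<zeta>\<^sub>2 0" and \<tau>: "\<tau> \<in> {0..h}"
  shows "\<zeta>\<^sub>1 \<tau> = \<zeta>\<^sub>2 \<tau>"
proof -
  define T where "T = {\<tau> \<in> {0..h}. \<zeta>\<^sub>1 \<tau> - \<zeta>\<^sub>2 \<tau> = 0}"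
  note cont = sol[THEN hamilton_solution_continuous]
  have "closedin (top_of_set {0..h}) T"
    unfolding T_def by (intro continuous_closedin_preimage_constant continuous_on_diff cont)
  moreover have "openin (top_of_set {0..h}) T"
    unfolding openin_euclidean_subtopology_iff
  proof (intro conjI ballI)
    show "T \<subseteq> {0..h}" by (auto simp: T_def)
    fix s assume s: "s \<in> T"
    then have s': "s \<in> {0..h}" "\<zeta>\<^sub>1 s = \<zeta>\<^sub>2 s" by (auto simp: T_def)
    then have "\<zeta>\<^sub>2 s \<in> B" using B by metis
    then obtain r where r: "r > 0" "ball (\<zeta>\<^sub>2 s) r \<subseteq> B"
      using \<open>open B\<close> open_contains_ball by blast
    then obtain e where e: "e > 0" "\<And>u. u \<in> {0..h} \<Longrightarrow> dist u s < e \<Longrightarrow> dist (\<zeta>\<^sub>2 u) (\<zeta>\<^sub>2 s) < r"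
      using cont(2) s'(1) unfolding continuous_on_iff by meson
    have "u \<in> T" if u: "u \<in> {0..h}" "dist u s < e" for u
    proof -
      let ?a = "min s u" and ?b = "max s u"
      have ab: "{?a..?b} \<subseteq> {0..h}" using u(1) s'(1) by auto
      have \<zeta>2: "\<zeta>\<^sub>2 v \<in> B" if v: "v \<in> {?a..?b}" for v
      proof -
        have "dist v s < e" using v u(2) by (auto simp: dist_real_def)
        then have "dist (\<zeta>\<^sub>2 v) (\<zeta>\<^sub>2 s) < r" using e(2) ab v by blast
        then show ?thesis using r(2) by (auto simp: dist_commute)
      qed
      have "(?b - ?a) * L \<le> h * L"
        using u(1) s'(1) lipschitz_on_nonneg[OF L(1)] by (intro mult_right_mono) auto
      then have "(?b - ?a) * L \<le> 1/4" using L(2) by linarith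
      then have "norm (\<zeta>\<^sub>1 u - \<zeta>\<^sub>2 u)
          \<le> 2 * (norm (fst (\<zeta>\<^sub>1 s) - fst (\<zeta>\<^sub>2 s)) + norm (snd (\<zeta>\<^sub>1 s) - snd (\<zeta>\<^sub>2 s)))"
        by (intro hamilton_solutions_stable[OF sol K L(1) _ ab B \<zeta>2]) (use ab in auto)
      then show ?thesis using s'(2) u(1) by (simp add: T_def)
    qed
    then show "\<exists>e>0. \<forall>x'\<in>{0..h}. dist x' s < e \<longrightarrow> x' \<in> T" using e(1) by blast
  qed
  moreover have "0 \<in> T" using \<tau> eq0 by (auto simp: T_def)
  ultimately have "T = {0..h}"
    using connected_clopen[of "{0..h}"] connected_Icc[of 0 h] by blast
  then have "\<tau> \<in> T" using \<tau> by (simp only:)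
  then show ?thesis by (simp add: T_def)
qed

lemma hamilton_solution_displacement:
  assumes sol: "hamilton_solution K D h \<zeta>"
    and K: "\<And>y. y \<in> D \<Longrightarrow> GDERIV K y :> grad K y"
    and M: "\<And>\<tau>. \<tau> \<in> {0..h} \<Longrightarrow> norm (grad K (\<zeta> \<tau>)) \<le> M"
    and st: "s \<in> {0..h}" "t \<in> {0..h}" "\<tau> \<in> {0..h}"
  shows "norm (\<zeta> \<tau> - (fst (\<zeta> s), snd (\<zeta> t))) \<le> 2 * M * h"
proof -
  have M0: "M \<ge> 0" using M[OF st(1)] norm_ge_zero order_trans by blast
  have "norm (fst (\<zeta> \<tau>) - fst (\<zeta> s)) \<le> M * \<bar>\<tau> - s\<bar>"
    by (rule vector_derivative_bound[OF convex_closed_interval hamilton_solutionD(2)[OF sol K]])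
       (use st order_trans[OF norm_fst_snd_le(2) M] in auto)
  moreover have "norm (snd (\<zeta> \<tau>) - snd (\<zeta> t)) \<le> M * \<bar>\<tau> - t\<bar>"
    by (rule vector_derivative_bound[OF convex_closed_interval hamilton_solutionD(3)[OF sol K]])
       (use st order_trans[OF norm_fst_snd_le(1) M] in auto)
  moreover have "M * \<bar>\<tau> - s\<bar> \<le> M * h" "M * \<bar>\<tau> - t\<bar> \<le> M * h"
    using st M0 by (auto intro!: mult_left_mono)
  ultimately show ?thesis
    using norm_fst_snd_le(3)[of "\<zeta> \<tau> - (fst (\<zeta> s), snd (\<zeta> t))"] by simp
qed

section \<open>The action integral\<close>

lemma action_at_0: "action K 0 \<zeta> = 0"
  unfolding action_def using integral_refl[of "0::real"] by simp

lemma action_has_integral: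
  assumes sol: "hamilton_solution K D h \<zeta>" and "h > 0" "open D"
    and C1: "Ck_on 1 K D"
  shows "((\<lambda>\<tau>. snd (\<zeta> \<tau>) \<bullet> snd (grad K (\<zeta> \<tau>)) - K (\<zeta> \<tau>)) has_integral action K h \<zeta>) {0..h}"
proof -
  note K = Ck_on_Suc_grad(1)[OF C1[unfolded One_nat_def] \<open>open D\<close>]
  let ?l = "\<lambda>\<tau>. snd (\<zeta> \<tau>) \<bullet> snd (grad K (\<zeta> \<tau>)) - K (\<zeta> \<tau>)"
  have \<zeta>D: "\<zeta> ` {0..h} \<subseteq> D" using hamilton_solutionD(1)[OF sol K] by blast
  have cK: "continuous_on D K"
    using K unfolding gderiv_def
    by (meson continuous_at_imp_continuous_on has_derivative_continuous)
  note c\<zeta> = hamilton_solution_continuous[OF sol]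
  have "continuous_on {0..h} ?l"
    by (intro continuous_intros c\<zeta> continuous_on_compose2[OF cK c\<zeta> \<zeta>D]
        continuous_on_compose2[OF continuous_on_grad[OF C1 \<open>open D\<close>] c\<zeta> \<zeta>D])
  then have *: "(?l has_integral integral {0..h} ?l) {0..h}"
    by (intro integrable_integral integrable_continuous_interval)
  have "vector_derivative (\<lambda>s. fst (\<zeta> s)) (at \<tau> within {0..h}) = snd (grad K (\<zeta> \<tau>))"
    if "\<tau> \<in> {0..h}" for \<tau>
    using vector_derivative_within_cbox[of 0 h \<tau>] hamilton_solutionD(2)[OF sol K that] that \<open>h > 0\<close>
    by simp
  then have "action K h \<zeta> = integral {0..h} ?l"
    unfolding action_def by (intro integral_cong) simp
  then show ?thesis using * by simp
qed

section \<open>Right and left boundary value problems in one formulation\<close>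

text \<open>In the right case \<open>q\<close> is prescribed at time \<open>0\<close> and \<open>p\<close> at time \<open>h\<close>; in the left case
it is the other way round. The sign \<open>orient\<close> makes
\<open>f h - f 0 = orient * (f (p_time) - f (q_time))\<close> hold in both cases.\<close>

definition q_time :: "bool \<Rightarrow> real \<Rightarrow> real" where
  "q_time right h = (if right then 0 else h)"

definition p_time :: "bool \<Rightarrow> real \<Rightarrow> real" where
  "p_time right h = (if right then h else 0)"

definition orient :: "bool \<Rightarrow> real" where
  "orient right = (if right then 1 else - 1)"

definition boundary_solutions ::
  "bool \<Rightarrow> ('n::finite ext_phase \<Rightarrow> real) \<Rightarrow> 'n ext_phase set
     \<Rightarrow> ('n ext_phase \<Rightarrow> real \<Rightarrow> real \<Rightarrow> 'n ext_phase) \<Rightarrow> bool" where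
  "boundary_solutions right K D Z \<longleftrightarrow>
     (\<forall>x\<in>D. \<forall>\<eta>>0. \<exists>\<epsilon>>0. \<forall>y\<in>ball x \<epsilon>. \<forall>h\<in>{0..<\<epsilon>}.
        hamilton_solution K D h (Z y h) \<and>
        fst (Z y h (q_time right h)) = fst y \<and> snd (Z y h (p_time right h)) = snd y \<and>
        (\<forall>\<tau>\<in>{0..h}. dist (Z y h \<tau>) x < \<eta>))"

definition generating ::
  "bool \<Rightarrow> ('n::finite ext_phase \<Rightarrow> real) \<Rightarrow> ('n ext_phase \<Rightarrow> real \<Rightarrow> real \<Rightarrow> 'n ext_phase)
     \<Rightarrow> 'n ext_phase \<Rightarrow> real \<Rightarrow> real" where
  "generating right K Z y h =
     orient right * (snd y \<bullet> fst (Z y h (p_time right h))) - action K h (Z y h)"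

text \<open>The left equations for a step from \<open>z\<close> to \<open>w\<close> are the right equations for a step from
\<open>w\<close> to \<open>z\<close> with the opposite sign of the momentum and position they produce. Here \<open>a\<close> is
the end point of the step at which \<open>q\<close> is prescribed, and \<open>b\<close> the one at which \<open>p\<close> is.\<close>

definition discrete_step ::
  "bool \<Rightarrow> 'n::finite ext_phase set \<Rightarrow> ('n ext_phase \<Rightarrow> real \<Rightarrow> real)
     \<Rightarrow> real \<Rightarrow> 'n ext_phase \<Rightarrow> 'n ext_phase \<Rightarrow> bool" where
  "discrete_step right D S h z w =
     (let a = (if right then z else w); b = (if right then w else z) in
      (fst a, snd b) \<in> D \<and>
      (GDERIV (\<lambda>q. S (q, snd b) h) (fst a) :> orient right *\<^sub>R snd a) \<and>
      (GDERIV (\<lambda>p. S (fst a, p) h) (snd b) :> orient right *\<^sub>R fst b))"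

lemma pq_time_in: "h \<ge> 0 \<Longrightarrow> q_time right h \<in> {0..h}" "h \<ge> 0 \<Longrightarrow> p_time right h \<in> {0..h}"
  by (auto simp: q_time_def p_time_def)

lemma boundary_solutions_iff:
  "right_bvp_solutions K D Z \<longleftrightarrow> boundary_solutions True K D Z"
  "left_bvp_solutions K D Z \<longleftrightarrow> boundary_solutions False K D Z"
proof -
  have *: "(\<forall>y\<in>ball x \<epsilon>. \<forall>h\<in>A. P y h) \<longleftrightarrow> (\<forall>a b. \<forall>h\<in>A. (a, b) \<in> ball x \<epsilon> \<longrightarrow> P (a, b) h)"
    for x :: "'a ext_phase" and \<epsilon> and A :: "real set" and P by auto
  show "right_bvp_solutions K D Z \<longleftrightarrow> boundary_solutions True K D Z"
    "left_bvp_solutions K D Z \<longleftrightarrow> boundary_solutions False K D Z"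
    unfolding right_bvp_solutions_def left_bvp_solutions_def boundary_solutions_def *
      q_time_def p_time_def fst_conv snd_conv if_True if_False by (rule refl)+
qed

lemma generating_eq:
  "exact_right K Z = generating True K Z" "exact_left K Z = generating False K Z"
  by (auto simp: fun_eq_iff exact_right_def exact_left_def generating_def orient_def p_time_def)

lemma discrete_step_eq:
  "right_step D S = discrete_step True D S" "left_step D S = discrete_step False D S"
  by (auto simp: fun_eq_iff right_step_def left_step_def discrete_step_def orient_def)

text \<open>With \<open>v\<close> the derivative of \<open>q\<close>, the boundary term is \<open>p(p_time) \<bullet> \<integral> v\<close>, so that the left-hand side is the integral of
\<open>(p(p_time) - p) \<bullet> v + (K - k)\<close>, which is small for a solution that stays close to one point.\<close>

lemma action_expansion:
  assumes sol: "hamilton_solution K D h \<zeta>" and "h > 0" "open D" and C1: "Ck_on 1 K D"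
    and bd: "\<And>\<tau>. \<tau> \<in> {0..h} \<Longrightarrow>
      \<bar>(snd (\<zeta> (p_time right h)) - snd (\<zeta> \<tau>)) \<bullet> snd (grad K (\<zeta> \<tau>)) + (K (\<zeta> \<tau>) - k)\<bar> \<le> \<omega>"
  shows "\<bar>orient right * (snd (\<zeta> (p_time right h))
            \<bullet> (fst (\<zeta> (p_time right h)) - fst (\<zeta> (q_time right h))))
          - action K h \<zeta> - h * k\<bar> \<le> \<omega> * h"
proof -
  note K = Ck_on_Suc_grad(1)[OF C1[unfolded One_nat_def] \<open>open D\<close>]
  let ?p = "snd (\<zeta> (p_time right h))"
  have "((\<lambda>\<tau>. snd (grad K (\<zeta> \<tau>))) has_integral (fst (\<zeta> h) - fst (\<zeta> 0))) {0..h}"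
    using \<open>h > 0\<close> by (intro fundamental_theorem_of_calculus hamilton_solutionD(2)[OF sol K]) auto
  from has_integral_linear[OF this bounded_linear_inner_right[of ?p]]
  have "((\<lambda>\<tau>. ?p \<bullet> snd (grad K (\<zeta> \<tau>))) has_integral ?p \<bullet> (fst (\<zeta> h) - fst (\<zeta> 0))) {0..h}"
    by (simp add: o_def)
  from has_integral_diff[OF has_integral_diff[OF this action_has_integral[OF sol \<open>h > 0\<close> \<open>open D\<close> C1]]
      has_integral_const_real[of k 0 h]]
  have "((\<lambda>\<tau>. (?p - snd (\<zeta> \<tau>)) \<bullet> snd (grad K (\<zeta> \<tau>)) + (K (\<zeta> \<tau>) - k)) has_integral
      ?p \<bullet> (fst (\<zeta> h) - fst (\<zeta> 0)) - action K h \<zeta> - h * k) {0..h}"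
    using \<open>h > 0\<close> by (simp add: inner_diff_left algebra_simps)
  moreover have "\<omega> \<ge> 0" using bd[of 0] \<open>h > 0\<close> by auto
  ultimately have "norm (?p \<bullet> (fst (\<zeta> h) - fst (\<zeta> 0)) - action K h \<zeta> - h * k) \<le> \<omega> * measure lborel {0..h}"
    by (intro has_integral_bound_real) (use bd in auto)
  then show ?thesis
    using \<open>h > 0\<close> by (cases right) (auto simp: orient_def p_time_def q_time_def inner_diff_right)
qed

text \<open>By Hamilton's equations the difference of the two Lagrangians is the derivative of
\<open>p \<bullet> (q' - q)\<close>, with \<open>q'\<close> the position along the second solution, plus
\<open>(p' - p) \<bullet> (K\<^sub>p' - K\<^sub>p)\<close> minus the second-order Taylor remainder of \<open>K\<close>; both
of these are at most \<open>L d\<^sup>2\<close>.\<close>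

lemma action_first_variation:
  assumes sol: "hamilton_solution K D h \<zeta>" "hamilton_solution K D h \<zeta>'"
    and "h > 0" "open D" and C1: "Ck_on 1 K D"
    and B: "convex B" "B \<subseteq> D" "L-lipschitz_on B (grad K)"
      "\<And>\<tau>. \<tau> \<in> {0..h} \<Longrightarrow> \<zeta> \<tau> \<in> B" "\<And>\<tau>. \<tau> \<in> {0..h} \<Longrightarrow> \<zeta>' \<tau> \<in> B"
    and d: "\<And>\<tau>. \<tau> \<in> {0..h} \<Longrightarrow> norm (\<zeta>' \<tau> - \<zeta> \<tau>) \<le> d"
  shows "\<bar>action K h \<zeta>' - action K h \<zeta>
    - (snd (\<zeta> h) \<bullet> (fst (\<zeta>' h) - fst (\<zeta> h)) - snd (\<zeta> 0) \<bullet> (fst (\<zeta>' 0) - fst (\<zeta> 0)))\<bar> \<le> 2 * L * d\<^sup>2 * h"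
proof -
  note K = Ck_on_Suc_grad(1)[OF C1[unfolded One_nat_def] \<open>open D\<close>]
  let ?g = "\<lambda>\<tau>. grad K (\<zeta> \<tau>)" and ?g' = "\<lambda>\<tau>. grad K (\<zeta>' \<tau>)"
  let ?b = "\<lambda>\<tau>. snd (\<zeta> \<tau>) \<bullet> (fst (\<zeta>' \<tau>) - fst (\<zeta> \<tau>))"
  let ?r = "\<lambda>\<tau>. snd (\<zeta>' \<tau> - \<zeta> \<tau>) \<bullet> snd (?g' \<tau> - ?g \<tau>)
    - (K (\<zeta>' \<tau>) - K (\<zeta> \<tau>) - (\<zeta>' \<tau> - \<zeta> \<tau>) \<bullet> ?g \<tau>)"
  have "(?b has_vector_derivative
      snd (\<zeta> \<tau>) \<bullet> (snd (?g' \<tau>) - snd (?g \<tau>)) + (- fst (?g \<tau>)) \<bullet> (fst (\<zeta>' \<tau>) - fst (\<zeta> \<tau>)))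
      (at \<tau> within {0..h})" if "\<tau> \<in> {0..h}" for \<tau>
    by (intro bounded_bilinear.has_vector_derivative[OF bounded_bilinear_inner]
        has_vector_derivative_diff hamilton_solutionD(2,3)[OF sol(1) K that]
        hamilton_solutionD(2)[OF sol(2) K that])
  then have "((\<lambda>\<tau>. snd (\<zeta> \<tau>) \<bullet> (snd (?g' \<tau>) - snd (?g \<tau>))
      + (- fst (?g \<tau>)) \<bullet> (fst (\<zeta>' \<tau>) - fst (\<zeta> \<tau>))) has_integral (?b h - ?b 0)) {0..h}"
    using \<open>h > 0\<close> by (intro fundamental_theorem_of_calculus) auto
  from has_integral_diff[OF has_integral_diff[OF action_has_integral[OF sol(2) \<open>h > 0\<close> \<open>open D\<close> C1]
        action_has_integral[OF sol(1) \<open>h > 0\<close> \<open>open D\<close> C1]] this]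
  have "(?r has_integral (action K h \<zeta>' - action K h \<zeta> - (?b h - ?b 0))) {0..h}"
    by (rule has_integral_eq[rotated])
       (simp add: inner_prod_def inner_diff_left inner_diff_right inner_commute algebra_simps)
  moreover have "norm (?r \<tau>) \<le> 2 * L * d\<^sup>2" if \<tau>: "\<tau> \<in> {0..h}" for \<tau>
  proof -
    let ?e = "norm (\<zeta>' \<tau> - \<zeta> \<tau>)"
    have L0: "L \<ge> 0" using lipschitz_on_nonneg[OF B(3)] .
    have "\<bar>snd (\<zeta>' \<tau> - \<zeta> \<tau>) \<bullet> snd (?g' \<tau> - ?g \<tau>)\<bar> \<le> norm (snd (\<zeta>' \<tau> - \<zeta> \<tau>)) * norm (snd (?g' \<tau> - ?g \<tau>))"
      by (rule Cauchy_Schwarz_ineq2)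
    also have "\<dots> \<le> ?e * norm (?g' \<tau> - ?g \<tau>)"
      by (intro mult_mono norm_fst_snd_le) auto
    also have "\<dots> \<le> ?e * (L * ?e)"
      using lipschitz_on_normD[OF B(3) B(5)[OF \<tau>] B(4)[OF \<tau>]] by (intro mult_left_mono) auto
    finally have 1: "\<bar>snd (\<zeta>' \<tau> - \<zeta> \<tau>) \<bullet> snd (?g' \<tau> - ?g \<tau>)\<bar> \<le> L * ?e\<^sup>2"
      by (simp add: power2_eq_square algebra_simps)
    have 2: "\<bar>K (\<zeta>' \<tau>) - K (\<zeta> \<tau>) - (\<zeta>' \<tau> - \<zeta> \<tau>) \<bullet> ?g \<tau>\<bar> \<le> L * ?e\<^sup>2"
      using B K \<tau> by (intro quadratic_remainder[of B]) auto
    have "L * ?e\<^sup>2 \<le> L * d\<^sup>2" using d[OF \<tau>] L0 by (intro mult_left_mono power_mono) auto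
    then show ?thesis using 1 2 unfolding real_norm_def by linarith
  qed
  moreover have "2 * L * d\<^sup>2 \<ge> 0" using lipschitz_on_nonneg[OF B(3)] by simp
  ultimately have "norm (action K h \<zeta>' - action K h \<zeta> - (?b h - ?b 0)) \<le> 2 * L * d\<^sup>2 * measure lborel {0..h}"
    by (intro has_integral_bound_real) auto
  then show ?thesis using \<open>h > 0\<close> by simp
qed

section \<open>Solving the implicit equations near the identity\<close>

text \<open>A solution of \<open>f y = z\<close> is a fixed point of \<open>y \<mapsto> z - (f y - y)\<close>, which maps the ball into
itself. It is applied to the map from boundary data to initial points, which differs from the
identity by \<open>O(h)\<close>.\<close>

lemma perturbed_identity_surjective:
  fixes f :: "'a::euclidean_space \<Rightarrow> 'a"
  assumes "\<delta> > 0" "continuous_on (cball x \<delta>) f"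
    and m: "\<And>y. y \<in> cball x \<delta> \<Longrightarrow> norm (f y - y) \<le> m" "dist z x + m \<le> \<delta>"
  obtains y where "y \<in> cball x \<delta>" "f y = z"
proof -
  have "norm (z - (f y - y) - x) \<le> \<delta>" if "y \<in> cball x \<delta>" for y
  proof -
    have "norm (z - (f y - y) - x) = norm ((z - x) - (f y - y))" by (simp add: algebra_simps)
    also have "\<dots> \<le> norm (z - x) + norm (f y - y)" by (rule norm_triangle_ineq4)
    finally show ?thesis using m(1)[OF that] m(2) by (simp add: dist_norm)
  qed
  then have maps: "(\<lambda>y. z - (f y - y)) \<in> cball x \<delta> \<rightarrow> cball x \<delta>"
    by (auto simp: dist_norm norm_minus_commute)
  have cont: "continuous_on (cball x \<delta>) (\<lambda>y. z - (f y - y))"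
    by (intro continuous_intros assms)
  obtain y where y: "y \<in> cball x \<delta>" "z - (f y - y) = y"
    by (rule brouwer_ball[OF assms(1) cont maps])
  have "f y = z" using y(2) by (simp add: algebra_simps)
  then show ?thesis by (rule that[OF y(1)])
qed

text \<open>Solvability near every point gives a different solution for every choice of the point and of the
tolerance. A single map serves all of them if it selects a solution whose distance from the initial
point is within \<open>h\<close> of the smallest possible one.\<close>

lemma near_identity_selection:
  assumes "\<And>x \<eta>. x \<in> D \<Longrightarrow> \<eta> > 0 \<Longrightarrow>
      \<exists>\<epsilon>>0. \<forall>z\<in>ball x \<epsilon>. \<forall>h\<in>{0<..<\<epsilon>}. \<exists>w. R h z w \<and> dist w x < \<eta>"
  shows "\<exists>F. near_identity_map D R F"
proof -
  define d where "d h z = Inf ((\<lambda>w. dist w z) ` {w. R h z w})" for h z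
  define F where "F h z = (SOME w. R h z w \<and> dist w z < d h z + h)" for h z
  have "near_identity_map D R F"
    unfolding near_identity_map_def
  proof (intro ballI allI impI)
    fix x and \<eta> :: real assume x: "x \<in> D" and \<eta>: "\<eta> > 0"
    then obtain \<epsilon> where \<epsilon>: "\<epsilon> > 0"
      "\<And>z h. z \<in> ball x \<epsilon> \<Longrightarrow> h \<in> {0<..<\<epsilon>} \<Longrightarrow> \<exists>w. R h z w \<and> dist w x < \<eta> / 4"
      using assms[OF x, of "\<eta> / 4"] by auto
    have "R h z (F h z) \<and> dist (F h z) x < \<eta>"
      if z: "z \<in> ball x (min \<epsilon> (\<eta> / 4))" and h: "h \<in> {0<..<min \<epsilon> (\<eta> / 4)}" for z h
    proof -
      obtain w where w: "R h z w" "dist w x < \<eta> / 4" using \<epsilon>(2)[of z h] z h by auto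
      have bdd: "bdd_below ((\<lambda>w. dist w z) ` {w. R h z w})" by (rule bdd_belowI[of _ 0]) auto
      have "d h z \<le> dist w z" unfolding d_def using w(1) bdd by (intro cInf_lower) auto
      also have "\<dots> < \<eta> / 2" using w(2) z dist_triangle[of w z x] by (simp add: dist_commute)
      finally have d: "d h z < \<eta> / 2" .
      have "\<exists>w. R h z w \<and> dist w z < d h z + h"
        using cInf_lessD[of "(\<lambda>w. dist w z) ` {w. R h z w}" "d h z + h", folded d_def] w(1) h
        by fastforce
      then have F: "R h z (F h z) \<and> dist (F h z) z < d h z + h"
        unfolding F_def by (rule someI_ex)
      then have "dist (F h z) x < \<eta>"
        using d h z dist_triangle[of "F h z" x z] by (simp add: dist_commute)
      then show ?thesis using F by blast
    qed
    then show "\<exists>\<epsilon>>0. \<forall>z\<in>ball x \<epsilon>. \<forall>h\<in>{0<..<\<epsilon>}. R h z (F h z) \<and> dist (F h z) x < \<eta>"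
      using \<epsilon>(1) \<eta> by (intro exI[of _ "min \<epsilon> (\<eta> / 4)"]) auto
  qed
  then show ?thesis by (rule exI[of _ F])
qed

section \<open>The exact discrete Hamiltonian generates the flow\<close>

text \<open>One exact discrete Hamiltonian, right or left. Besides \<open>K \<in> C\<^sup>1\<close> the only source of regularity
is \<open>smooth\<close>, which is a condition on values of the action and not on the solutions \<open>Z\<close>.\<close>

locale exact_discrete_hamiltonian =
  fixes K :: "'n::finite ext_phase \<Rightarrow> real" and D :: "'n ext_phase set" and right :: bool
    and Z :: "'n ext_phase \<Rightarrow> real \<Rightarrow> real \<Rightarrow> 'n ext_phase"
  assumes open_D: "open D"
    and C1: "Ck_on 1 K D"
    and bvp: "boundary_solutions right K D Z"
    and smooth: "smooth_for_small_h D (generating right K Z)"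
begin

lemmas GDERIV_K = Ck_on_Suc_grad(1)[OF C1[unfolded One_nat_def] open_D]

text \<open>The solution of the boundary value problem with data \<open>y\<close> stays close to \<open>y\<close>, so the integrand
in \<open>action_expansion\<close> is small for \<open>k = K y\<close>.\<close>

lemma generating_derivative_at_0:
  assumes y: "y \<in> D"
  shows "(generating right K Z y has_vector_derivative K y) (at 0 within {0..b})"
  unfolding has_vector_derivative_def has_derivative_within_alt
proof (intro conjI allI impI)
  show "bounded_linear (\<lambda>h. h *\<^sub>R K y)" by (rule bounded_linear_scaleR_left)
  fix e :: real assume e: "e > 0"
  define M where "M = norm (grad K y) + 1"
  have M: "M > 0" by (simp add: M_def add_nonneg_pos)
  have "isCont (grad K) y"
    using continuous_on_grad[OF C1 open_D] y open_D continuous_on_eq_continuous_at by blast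
  then obtain d1 where d1: "d1 > 0" "\<And>u. dist u y < d1 \<Longrightarrow> dist (grad K u) (grad K y) < 1"
    unfolding continuous_at_eps_delta by (meson zero_less_one)
  have "isCont K y" using GDERIV_K[OF y] unfolding gderiv_def by (rule has_derivative_continuous)
  then obtain d2 where d2: "d2 > 0" "\<And>u. dist u y < d2 \<Longrightarrow> dist (K u) (K y) < e / 2"
    unfolding continuous_at_eps_delta using e by (meson half_gt_zero)
  \<comment> \<open>Within distance \<open>\<eta>\<close> of \<open>y\<close> the first term of \<open>action_expansion\<close> is at most
\<open>2 \<eta> M \<le> e / 2\<close>, and \<open>K\<close> varies by at most \<open>e / 2\<close>.\<close>
  define \<eta> where "\<eta> = min (min d1 d2) (e / (4 * M))"
  have \<eta>: "\<eta> > 0" "\<eta> \<le> d1" "\<eta> \<le> d2" "\<eta> \<le> e / (4 * M)"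
    using d1 d2 M e by (auto simp: \<eta>_def)
  obtain \<epsilon> where \<epsilon>: "\<epsilon> > 0" and sol: "\<And>h. h \<in> {0..<\<epsilon>} \<Longrightarrow>
        hamilton_solution K D h (Z y h) \<and>
        fst (Z y h (q_time right h)) = fst y \<and> snd (Z y h (p_time right h)) = snd y \<and>
        (\<forall>\<tau>\<in>{0..h}. dist (Z y h \<tau>) y < \<eta>)"
    using bvp[unfolded boundary_solutions_def] y \<eta>(1) by (metis centre_in_ball)
  have S0: "generating right K Z y 0 = orient right * (snd y \<bullet> fst y)"
    using sol[of 0] \<epsilon> unfolding generating_def action_at_0 by (simp add: q_time_def p_time_def)
  have "norm (generating right K Z y h - generating right K Z y 0 - (h - 0) *\<^sub>R K y) \<le> e * norm (h - 0)"
    if h: "h \<in> {0..b}" "norm (h - 0) < \<epsilon>" for h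
  proof (cases "h = 0")
    case False
    then have h': "h > 0" "h \<in> {0..<\<epsilon>}" using h by auto
    let ?\<zeta> = "Z y h"
    have near: "\<bar>(snd (?\<zeta> (p_time right h)) - snd (?\<zeta> \<tau>)) \<bullet> snd (grad K (?\<zeta> \<tau>)) + (K (?\<zeta> \<tau>) - K y)\<bar> \<le> e"
      if \<tau>: "\<tau> \<in> {0..h}" for \<tau>
    proof -
      have 1: "dist (?\<zeta> \<tau>) y < \<eta>" "dist (?\<zeta> (p_time right h)) y < \<eta>"
        using sol[OF h'(2)] \<tau> pq_time_in(2)[of h right] h'(1) by auto
      have "norm (snd (?\<zeta> (p_time right h)) - snd (?\<zeta> \<tau>)) \<le> norm (?\<zeta> (p_time right h) - ?\<zeta> \<tau>)"
        using norm_fst_snd_le(2)[of "?\<zeta> (p_time right h) - ?\<zeta> \<tau>"] by simp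
      also have "\<dots> \<le> 2 * \<eta>"
        using 1 dist_triangle2[of "?\<zeta> (p_time right h)" "?\<zeta> \<tau>" y] by (simp add: dist_norm)
      finally have p: "norm (snd (?\<zeta> (p_time right h)) - snd (?\<zeta> \<tau>)) \<le> 2 * \<eta>" .
      have "dist (grad K (?\<zeta> \<tau>)) (grad K y) < 1"
        using 1 \<eta> by (intro d1(2)) linarith
      then have "norm (grad K (?\<zeta> \<tau>)) \<le> M"
        using norm_triangle_ineq2[of "grad K (?\<zeta> \<tau>)" "grad K y"] by (simp add: M_def dist_norm)
      then have g: "norm (snd (grad K (?\<zeta> \<tau>))) \<le> M"
        using norm_fst_snd_le(2) order_trans by blast
      have "\<bar>(snd (?\<zeta> (p_time right h)) - snd (?\<zeta> \<tau>)) \<bullet> snd (grad K (?\<zeta> \<tau>))\<bar> \<le> (2 * \<eta>) * M"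
        using \<eta>(1) by (intro order_trans[OF Cauchy_Schwarz_ineq2] mult_mono p g) auto
      also have "\<dots> \<le> e / 2" using \<eta>(4) M by (simp add: field_simps)
      finally have "\<bar>(snd (?\<zeta> (p_time right h)) - snd (?\<zeta> \<tau>)) \<bullet> snd (grad K (?\<zeta> \<tau>))\<bar> \<le> e / 2" .
      moreover have "\<bar>K (?\<zeta> \<tau>) - K y\<bar> < e / 2" using d2(2)[of "?\<zeta> \<tau>"] 1 \<eta> by (simp add: dist_real_def)
      ultimately show ?thesis by linarith
    qed
    have "hamilton_solution K D h ?\<zeta>" using sol[OF h'(2)] by blast
    from action_expansion[OF this h'(1) open_D C1 near]
    show ?thesis using sol[OF h'(2)] h'(1)
      unfolding S0 by (simp add: generating_def inner_diff_right algebra_simps)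
  qed simp
  then show "\<exists>d>0. \<forall>h\<in>{0..b}. norm (h - 0) < d \<longrightarrow>
      norm (generating right K Z y h - generating right K Z y 0 - (h - 0) *\<^sub>R K y) \<le> e * norm (h - 0)"
    using \<epsilon> by blast
qed

text \<open>The derivative of the \<open>C\<^sup>3\<close> function \<open>(y, h) \<mapsto> S(y, h)\<close> in the direction
\<open>(0, 1)\<close> is \<open>C\<^sup>2\<close>, and on the face \<open>h = 0\<close> it equals \<open>K\<close>.\<close>

lemma K_locally_C2:
  assumes "x \<in> D"
  shows "\<exists>\<epsilon>>0. ball x \<epsilon> \<subseteq> D \<and> Ck_on 2 K (ball x \<epsilon>)"
proof -
  obtain \<epsilon>1 where \<epsilon>1: "\<epsilon>1 > 0" "Ck_on 3 (\<lambda>(y, h). generating right K Z y h) (ball x \<epsilon>1 \<times> {0..<\<epsilon>1})"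
    using smooth assms unfolding smooth_for_small_h_def by blast
  obtain \<epsilon>2 where \<epsilon>2: "\<epsilon>2 > 0" "ball x \<epsilon>2 \<subseteq> D" using open_D assms open_contains_ball by blast
  define \<epsilon> where "\<epsilon> = min \<epsilon>1 \<epsilon>2"
  define b where "b = \<epsilon>1 / 2"
  have \<epsilon>: "\<epsilon> > 0" "ball x \<epsilon> \<subseteq> D" "b > 0" using \<epsilon>1 \<epsilon>2 by (auto simp: \<epsilon>_def b_def)
  let ?S = "\<lambda>(y, h). generating right K Z y h" and ?B = "ball x \<epsilon> \<times> {0..b}"
  have "?B \<subseteq> ball x \<epsilon>1 \<times> {0..<\<epsilon>1}" using \<epsilon>1(1) by (auto simp: \<epsilon>_def b_def)
  then have "Ck_on (Suc 2) ?S ?B"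
    using Ck_on_subset[OF \<epsilon>1(2)] by (simp only: eval_nat_numeral)
  then obtain S' where S': "\<And>u. u \<in> ?B \<Longrightarrow> (?S has_derivative S' u) (at u within ?B)"
    and C2: "\<And>v. Ck_on 2 (\<lambda>u. S' u v) ?B"
    unfolding Ck_on.simps(2) by blast
  have "Ck_on 2 (\<lambda>y. S' (y, 0) (0, 1)) (ball x \<epsilon>)"
    using Ck_on_slice[OF C2] \<epsilon>(3) by simp
  moreover have "S' (y, 0) (0, 1) = K y" if y: "y \<in> ball x \<epsilon>" for y
  proof -
    have "((\<lambda>h. ?S (y, h)) has_derivative (\<lambda>h. S' (y, 0) (0, h))) (at 0 within {0..b})"
      by (rule has_derivative_in_compose2[of ?B ?S S' "\<lambda>h. (y, h)" "{0..b}" 0 "\<lambda>h. (0, h)"])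
         (use S' y \<epsilon>(3) in \<open>auto intro!: derivative_eq_intros\<close>)
    moreover have "(\<lambda>h. S' (y, 0) (0, h)) = (\<lambda>h. h *\<^sub>R S' (y, 0) (0, 1))"
    proof
      fix h :: real
      have "linear (S' (y, 0))" 
        by (rule has_derivative_linear[OF S']) (use y \<epsilon>(3) in simp)
      from linear_scale[OF this, of h "(0, 1)"]
      show "S' (y, 0) (0, h) = h *\<^sub>R S' (y, 0) (0, 1)" by simp
    qed
    ultimately have "(generating right K Z y has_vector_derivative S' (y, 0) (0, 1)) (at 0 within {0..b})"
      unfolding has_vector_derivative_def by (simp only: prod.case)
    moreover have "(generating right K Z y has_vector_derivative K y) (at 0 within {0..b})"
      using generating_derivative_at_0 y \<epsilon>(2) by blast
    ultimately show ?thesis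
      using vector_derivative_unique_within_closed_interval[of 0 b 0] \<epsilon>(3) by simp
  qed
  ultimately have "Ck_on 2 K (ball x \<epsilon>)" by (rule Ck_on_cong)
  then show ?thesis using \<epsilon> by blast
qed

text \<open>All that the order estimate needs to know about the exact problem near \<open>x\<close>, with one radius
\<open>\<epsilon>\<close> (also the bound for \<open>h\<close>) and one constant \<open>C\<close>.\<close>

definition bvp_controlled :: "'n ext_phase \<Rightarrow> real \<Rightarrow> real \<Rightarrow> bool" where
  "bvp_controlled x \<epsilon> C \<longleftrightarrow> \<epsilon> > 0 \<and> C \<ge> 0 \<and> ball x \<epsilon> \<subseteq> D \<and>
     (\<forall>y\<in>ball x \<epsilon>. \<forall>h\<in>{0..<\<epsilon>}.
        hamilton_solution K D h (Z y h) \<and>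
        fst (Z y h (q_time right h)) = fst y \<and> snd (Z y h (p_time right h)) = snd y \<and>
        (\<forall>\<tau>\<in>{0..h}. norm (Z y h \<tau> - y) \<le> C * h) \<and>
        (\<forall>y'\<in>ball x \<epsilon>. \<forall>\<tau>\<in>{0..h}. norm (Z y' h \<tau> - Z y h \<tau>) \<le> C * norm (y' - y)) \<and>
        (\<forall>y'\<in>ball x \<epsilon>. norm (Z y' h h - Z y h h) \<le> C * norm (Z y' h 0 - Z y h 0)) \<and>
        (\<forall>\<zeta>. hamilton_solution K D h \<zeta> \<longrightarrow> Z y h 0 = \<zeta> 0 \<longrightarrow> Z y h h = \<zeta> h) \<and>
        (h > 0 \<longrightarrow> (GDERIV (\<lambda>y. generating right K Z y h) y
          :> orient right *\<^sub>R (snd (Z y h (q_time right h)), fst (Z y h (p_time right h))))))"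

lemma bvp_controlledD:
  assumes "bvp_controlled x \<epsilon> C"
  shows "\<epsilon> > 0" "C \<ge> 0" "ball x \<epsilon> \<subseteq> D"
    and "\<And>y h. y \<in> ball x \<epsilon> \<Longrightarrow> h \<in> {0..<\<epsilon>} \<Longrightarrow> hamilton_solution K D h (Z y h)"
    and "\<And>y h. y \<in> ball x \<epsilon> \<Longrightarrow> h \<in> {0..<\<epsilon>} \<Longrightarrow> fst (Z y h (q_time right h)) = fst y"
    and "\<And>y h. y \<in> ball x \<epsilon> \<Longrightarrow> h \<in> {0..<\<epsilon>} \<Longrightarrow> snd (Z y h (p_time right h)) = snd y"
    and "\<And>y h \<tau>. y \<in> ball x \<epsilon> \<Longrightarrow> h \<in> {0..<\<epsilon>} \<Longrightarrow> \<tau> \<in> {0..h} \<Longrightarrow> norm (Z y h \<tau> - y) \<le> C * h"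
    and "\<And>y y' h \<tau>. y \<in> ball x \<epsilon> \<Longrightarrow> y' \<in> ball x \<epsilon> \<Longrightarrow> h \<in> {0..<\<epsilon>} \<Longrightarrow> \<tau> \<in> {0..h} \<Longrightarrow>
        norm (Z y' h \<tau> - Z y h \<tau>) \<le> C * norm (y' - y)"
    and "\<And>y y' h. y \<in> ball x \<epsilon> \<Longrightarrow> y' \<in> ball x \<epsilon> \<Longrightarrow> h \<in> {0..<\<epsilon>} \<Longrightarrow>
        norm (Z y' h h - Z y h h) \<le> C * norm (Z y' h 0 - Z y h 0)"
    and "\<And>y h \<zeta>. y \<in> ball x \<epsilon> \<Longrightarrow> h \<in> {0..<\<epsilon>} \<Longrightarrow> hamilton_solution K D h \<zeta> \<Longrightarrow>
        Z y h 0 = \<zeta> 0 \<Longrightarrow> Z y h h = \<zeta> h"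
    and "\<And>y h. y \<in> ball x \<epsilon> \<Longrightarrow> h \<in> {0..<\<epsilon>} \<Longrightarrow> h > 0 \<Longrightarrow> GDERIV (\<lambda>y. generating right K Z y h) y
        :> orient right *\<^sub>R (snd (Z y h (q_time right h)), fst (Z y h (p_time right h)))"
  using assms unfolding bvp_controlled_def by blast+

text \<open>Everything follows from the local Lipschitz bound for the gradient of \<open>K\<close>. The gradient of the
exact discrete Hamiltonian is read off from \<open>action_first_variation\<close>: the difference of the
values at \<open>y'\<close> and \<open>y\<close> is the linear term up to a remainder of order
\<open>norm (y' - y)\<^sup>2\<close>, because the solutions depend Lipschitz continuously on the boundary data. In
this way differentiability of the solutions in the data is avoided.\<close>

lemma bvp_locally_controlled:
  assumes x: "x \<in> D"
  shows "\<exists>\<epsilon> C. bvp_controlled x \<epsilon> C"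
proof -
  obtain \<epsilon>1 where \<epsilon>1: "\<epsilon>1 > 0" "ball x \<epsilon>1 \<subseteq> D" "Ck_on 2 K (ball x \<epsilon>1)"
    using K_locally_C2[OF x] by blast
  obtain \<rho> L where \<rho>: "\<rho> > 0" "ball x \<rho> \<subseteq> ball x \<epsilon>1" and L: "L-lipschitz_on (ball x \<rho>) (grad K)"
    using Ck_on_2_grad_lipschitz[OF \<epsilon>1(3) open_ball] \<epsilon>1(1) by (metis centre_in_ball)
  let ?B = "ball x \<rho>"
  have BD: "?B \<subseteq> D" using \<rho>(2) \<epsilon>1(2) by blast
  have L0: "L \<ge> 0" using lipschitz_on_nonneg[OF L] .
  obtain \<epsilon>2 where \<epsilon>2: "\<epsilon>2 > 0" and Z: "\<And>y h. y \<in> ball x \<epsilon>2 \<Longrightarrow> h \<in> {0..<\<epsilon>2} \<Longrightarrow>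
        hamilton_solution K D h (Z y h) \<and>
        fst (Z y h (q_time right h)) = fst y \<and> snd (Z y h (p_time right h)) = snd y \<and>
        (\<forall>\<tau>\<in>{0..h}. dist (Z y h \<tau>) x < \<rho>)"
    using bvp x \<rho>(1) unfolding boundary_solutions_def by metis
  define M where "M = norm (grad K x) + L * \<rho>"
  have M: "norm (grad K u) \<le> M" if u: "u \<in> ?B" for u
  proof -
    have "norm (grad K u - grad K x) \<le> L * norm (u - x)"
      using lipschitz_on_normD[OF L u] \<rho>(1) by simp
    also have "\<dots> \<le> L * \<rho>" using u L0 by (intro mult_left_mono) (auto simp: dist_norm norm_minus_commute)
    finally show ?thesis using norm_triangle_ineq2[of "grad K u" "grad K x"] by (simp add: M_def)
  qed
  have M0: "M \<ge> 0" using L0 \<rho>(1) by (simp add: M_def)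
  \<comment> \<open>The last bound makes \<open>h L \<le> 1/4\<close>, as \<open>two_point_stability\<close> requires.\<close>
  define \<epsilon> where "\<epsilon> = min (min \<epsilon>2 \<rho>) (1 / (4 * (L + 1)))"
  have \<epsilon>: "\<epsilon> > 0" "\<epsilon> \<le> \<epsilon>2" "\<epsilon> \<le> \<rho>" "\<epsilon> \<le> 1 / (4 * (L + 1))"
    using \<epsilon>2 \<rho> L0 by (auto simp: \<epsilon>_def)
  define C where "C = 4 + 2 * M"
  have C: "C \<ge> 0" "C \<ge> 4" "C \<ge> 2 * M" using M0 by (auto simp: C_def)
  have hL: "h * L \<le> 1/4" if "h \<in> {0..<\<epsilon>}" for h
  proof -
    have "h * L \<le> \<epsilon> * (L + 1)" using that L0 by (intro mult_mono) auto
    also have "\<dots> \<le> 1 / (4 * (L + 1)) * (L + 1)" using \<epsilon>(4) L0 by (intro mult_right_mono) auto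
    also have "\<dots> = 1/4" using L0 by (simp add: field_simps)
    finally show ?thesis .
  qed
  have sol: "hamilton_solution K D h (Z y h)"
    and q: "fst (Z y h (q_time right h)) = fst y" and p: "snd (Z y h (p_time right h)) = snd y"
    and ZB: "\<And>\<tau>. \<tau> \<in> {0..h} \<Longrightarrow> Z y h \<tau> \<in> ?B"
    if "y \<in> ball x \<epsilon>" "h \<in> {0..<\<epsilon>}" for y h
    using Z[of y h] that \<epsilon>(2) by (auto simp: dist_commute)
  have stable: "norm (Z y' h \<tau> - Z y h \<tau>)
      \<le> 2 * (norm (fst (Z y' h s) - fst (Z y h s)) + norm (snd (Z y' h t) - snd (Z y h t)))"
    if "y \<in> ball x \<epsilon>" "y' \<in> ball x \<epsilon>" "h \<in> {0..<\<epsilon>}" "s \<in> {0..h}" "t \<in> {0..h}" "\<tau> \<in> {0..h}" for y y' h s t \<tau>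
    using hamilton_solutions_stable[OF sol[OF that(2,3)] sol[OF that(1,3)] GDERIV_K L _ subset_refl
      ZB[OF that(2,3)] ZB[OF that(1,3)] that(4-6)] hL[OF that(3)] by simp
  have four: "2 * (norm (fst u - fst v) + norm (snd u - snd v)) \<le> 4 * norm (u - v)"
    for u v :: "'n ext_phase"
    using norm_fst_snd_le(1,2)[of "u - v"] by simp
  have lip: "norm (Z y' h \<tau> - Z y h \<tau>) \<le> 4 * norm (y' - y)"
    if "y \<in> ball x \<epsilon>" "y' \<in> ball x \<epsilon>" "h \<in> {0..<\<epsilon>}" "\<tau> \<in> {0..h}" for y y' h \<tau>
    using stable[OF that(1-3) pq_time_in[of h right] that(4)] that(3) four[of y' y]
    unfolding q[OF that(1,3)] q[OF that(2,3)] p[OF that(1,3)] p[OF that(2,3)] by simp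
  have "bvp_controlled x \<epsilon> C"
    unfolding bvp_controlled_def
  proof (intro conjI ballI allI impI)
    show "\<epsilon> > 0" "C \<ge> 0" by fact+
    show "ball x \<epsilon> \<subseteq> D" using \<epsilon>(3) BD by auto
    fix y h assume y: "y \<in> ball x \<epsilon>" and h: "h \<in> {0..<\<epsilon>}"
    show "hamilton_solution K D h (Z y h)" "fst (Z y h (q_time right h)) = fst y"
      "snd (Z y h (p_time right h)) = snd y"
      using sol q p y h by blast+
    show "norm (Z y' h \<tau> - Z y h \<tau>) \<le> C * norm (y' - y)"
      if "y' \<in> ball x \<epsilon>" "\<tau> \<in> {0..h}" for y' \<tau>
      using lip[OF y that(1) h that(2)] mult_right_mono[OF C(2), of "norm (y' - y)"] by simp
    show "norm (Z y h \<tau> - y) \<le> C * h" if "\<tau> \<in> {0..h}" for \<tau>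
    proof -
      have "norm (Z y h \<tau> - y) \<le> 2 * M * h"
        using hamilton_solution_displacement[OF sol[OF y h] GDERIV_K M[OF ZB[OF y h]]
            pq_time_in[of h right] that] h by (simp add: q[OF y h] p[OF y h])
      then show ?thesis using mult_right_mono[OF C(3), of h] h by simp
    qed
    show "norm (Z y' h h - Z y h h) \<le> C * norm (Z y' h 0 - Z y h 0)" if "y' \<in> ball x \<epsilon>" for y'
      using stable[OF y that h, of 0 0 h] four[of "Z y' h 0" "Z y h 0"]
        mult_right_mono[OF C(2), of "norm (Z y' h 0 - Z y h 0)"] h by simp
    show "Z y h h = \<zeta> h" if "hamilton_solution K D h \<zeta>" "Z y h 0 = \<zeta> 0" for \<zeta>
      using hamilton_solution_unique[OF sol[OF y h] that(1) GDERIV_K L hL[OF h] open_ball ZB[OF y h] that(2)]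
        h by simp
  next
    fix y h assume y: "y \<in> ball x \<epsilon>" and h': "h \<in> {0..<\<epsilon>}" "h > 0"
    let ?\<sigma> = "orient right" and ?p = "p_time right h" and ?q = "q_time right h"
    let ?S = "\<lambda>y. generating right K Z y h"
    let ?G = "?\<sigma> *\<^sub>R (snd (Z y h ?q), fst (Z y h ?p))"
    obtain d where d: "d > 0" "ball y d \<subseteq> ball x \<epsilon>" using y open_contains_ball open_ball by blast
    have "\<bar>?S y' - ?S y - (y' - y) \<bullet> ?G\<bar> \<le> (4 + 32 * L * h) * (norm (y' - y))\<^sup>2"
      if y': "y' \<in> ball y d" for y'
    proof -
      have y': "y' \<in> ball x \<epsilon>" using y' d(2) by blast
      let ?n = "norm (y' - y)"
      \<comment> \<open>The remainder of the action beyond its boundary terms.\<close>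
      define R where "R = action K h (Z y' h) - action K h (Z y h)
        - (snd (Z y h h) \<bullet> (fst (Z y' h h) - fst (Z y h h))
          - snd (Z y h 0) \<bullet> (fst (Z y' h 0) - fst (Z y h 0)))"
      have "\<bar>R\<bar> \<le> 2 * L * (4 * ?n)\<^sup>2 * h"
        unfolding R_def
        by (rule action_first_variation[OF sol[OF y h'(1)] sol[OF y' h'(1)] h'(2) open_D C1
              convex_ball BD L ZB[OF y h'(1)] ZB[OF y' h'(1)] lip[OF y y' h'(1)]])
      then have R: "\<bar>R\<bar> \<le> 32 * L * h * ?n\<^sup>2" by (simp add: power_mult_distrib mult_ac)
      have "snd (Z y h h) \<bullet> (fst (Z y' h h) - fst (Z y h h))
          - snd (Z y h 0) \<bullet> (fst (Z y' h 0) - fst (Z y h 0))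
        = ?\<sigma> * (snd y \<bullet> (fst (Z y' h ?p) - fst (Z y h ?p)) - snd (Z y h ?q) \<bullet> (fst y' - fst y))"
        using q[OF y h'(1)] q[OF y' h'(1)] p[OF y h'(1)]
        by (cases right) (auto simp: orient_def q_time_def p_time_def)
      then have "?S y' - ?S y - (y' - y) \<bullet> ?G
        = ?\<sigma> * ((snd y' - snd y) \<bullet> (fst (Z y' h ?p) - fst (Z y h ?p))) - R"
        unfolding R_def generating_def
        by (simp add: inner_prod_def inner_diff_left inner_diff_right inner_commute algebra_simps)
      moreover have "\<bar>?\<sigma> * ((snd y' - snd y) \<bullet> (fst (Z y' h ?p) - fst (Z y h ?p)))\<bar> \<le> ?n * (4 * ?n)"
      proof -
        have "\<bar>?\<sigma> * ((snd y' - snd y) \<bullet> (fst (Z y' h ?p) - fst (Z y h ?p)))\<bar>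
            = \<bar>(snd y' - snd y) \<bullet> (fst (Z y' h ?p) - fst (Z y h ?p))\<bar>"
          by (simp add: orient_def abs_mult)
        also have "\<dots> \<le> norm (snd y' - snd y) * norm (fst (Z y' h ?p) - fst (Z y h ?p))"
          by (rule Cauchy_Schwarz_ineq2)
        also have "\<dots> \<le> ?n * (4 * ?n)"
        proof (rule mult_mono)
          show "norm (snd y' - snd y) \<le> ?n" using norm_fst_snd_le(2)[of "y' - y"] by simp
          show "norm (fst (Z y' h ?p) - fst (Z y h ?p)) \<le> 4 * ?n"
            using norm_fst_snd_le(1)[of "Z y' h ?p - Z y h ?p"] lip[OF y y' h'(1) pq_time_in(2)[of h right]] h'(2)
            by simp
        qed auto
        finally show ?thesis .
      qed
      ultimately show ?thesis using R by (simp add: power2_eq_square algebra_simps)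
    qed
    then show "GDERIV ?S y :> ?G" by (rule GDERIV_of_quadratic_bound[OF d(1)])
  qed
  then show ?thesis by blast
qed

section \<open>Order of the discrete Hamiltonian map\<close>

text \<open>The exact solution with boundary data \<open>y\<close> satisfies the step equations of \<open>S\<close>; those of
\<open>S + h\<^bsup>r+1\<^esup> e\<close> change the unprescribed components \<open>p\<close> at \<open>q_time\<close> and \<open>q\<close> at
\<open>p_time\<close> by the components of \<open>h\<^bsup>r+1\<^esup> \<nabla>e\<close>, up to the sign \<open>orient\<close>. Sorted by time
instead, these changes are a perturbation \<open>a\<close> of the initial point and a perturbation \<open>b\<close> of the
end point of the exact solution, and the step with data \<open>y\<close> is determined by them.\<close>

lemma local_discrete_step:
  assumes approx: "approximates_to_order r D Hd (generating right K Z)"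
  obtains a b where "\<And>x. x \<in> D \<Longrightarrow> \<exists>\<epsilon>>0. \<exists>M. \<forall>h\<in>{0<..<\<epsilon>}.
    continuous_on (ball x \<epsilon>) (a h) \<and>
    (\<forall>y\<in>ball x \<epsilon>. norm (a h y) \<le> M * h ^ (r + 1) \<and> norm (b h y) \<le> M * h ^ (r + 1) \<and>
      discrete_step right D Hd h (Z y h 0 + a h y) (Z y h h + b h y) \<and>
      (\<forall>z w. discrete_step right D Hd h z w \<longrightarrow> y = (if right then (fst z, snd w) else (fst w, snd z))
        \<longrightarrow> z = Z y h 0 + a h y \<and> w = Z y h h + b h y))"
proof -
  obtain e where e: "\<And>x. x\<in>D \<Longrightarrow> \<exists>\<epsilon>>0. \<exists>M. \<forall>h\<in>{0<..<\<epsilon>}.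
        Ck_on 2 (\<lambda>y. e y h) (ball x \<epsilon>) \<and>
        (\<forall>y\<in>ball x \<epsilon>.
           Hd y h = generating right K Z y h + h ^ (r + 1) * e y h \<and>
           \<bar>e y h\<bar> \<le> M \<and>
           norm (grad (\<lambda>y. e y h) y) \<le> M \<and>
           onorm (frechet_derivative (grad (\<lambda>y. e y h)) (at y)) \<le> M)"
    using approx unfolding approximates_to_order_def by blast
  let ?\<sigma> = "orient right"
  define c where "c h y = (h ^ (r + 1) * ?\<sigma>) *\<^sub>R grad (\<lambda>y. e y h) y" for h y
  define a where "a h y = (if right then (0, fst (c h y)) else (snd (c h y), 0))" for h y
  define b where "b h y = (if right then (snd (c h y), 0) else (0, fst (c h y)))" for h y
  have \<sigma>: "?\<sigma> * ?\<sigma> = 1" by (simp add: orient_def)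
  show ?thesis
  proof (rule that[of a b])
    fix x assume x: "x \<in> D"
    obtain \<epsilon>1 C where loc: "bvp_controlled x \<epsilon>1 C" using bvp_locally_controlled[OF x] by blast
    note \<epsilon>1 = bvp_controlledD(1,3)[OF loc] and q = bvp_controlledD(5)[OF loc]
      and p = bvp_controlledD(6)[OF loc] and S = bvp_controlledD(11)[OF loc]
    obtain \<epsilon>2 M where \<epsilon>2: "\<epsilon>2 > 0" and e2: "\<And>h. h \<in> {0<..<\<epsilon>2} \<Longrightarrow> Ck_on 2 (\<lambda>y. e y h) (ball x \<epsilon>2)"
      and Hd: "\<And>h y. h \<in> {0<..<\<epsilon>2} \<Longrightarrow> y \<in> ball x \<epsilon>2 \<Longrightarrow>
        Hd y h = generating right K Z y h + h ^ (r + 1) * e y h"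
      and M: "\<And>h y. h \<in> {0<..<\<epsilon>2} \<Longrightarrow> y \<in> ball x \<epsilon>2 \<Longrightarrow> norm (grad (\<lambda>y. e y h) y) \<le> M"
      using e[OF x] by blast
    define \<epsilon> where "\<epsilon> = min \<epsilon>1 \<epsilon>2"
    have \<epsilon>: "\<epsilon> > 0" "\<epsilon> \<le> \<epsilon>1" "\<epsilon> \<le> \<epsilon>2" using \<epsilon>1 \<epsilon>2 by (auto simp: \<epsilon>_def)
    have cont: "continuous_on (ball x \<epsilon>) (a h)" if h: "h \<in> {0<..<\<epsilon>}" for h
    proof -
      have "Ck_on 1 (\<lambda>y. e y h) (ball x \<epsilon>2)"
        using h \<epsilon>(3) by (intro Ck_on_2_imp_1 e2) simp
      then have "continuous_on (ball x \<epsilon>2) (grad (\<lambda>y. e y h))" by (rule continuous_on_grad) simp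
      then have "continuous_on (ball x \<epsilon>) (grad (\<lambda>y. e y h))"
        by (rule continuous_on_subset) (use \<epsilon>(3) in auto)
      then show ?thesis unfolding a_def c_def by (cases right) (auto intro!: continuous_intros)
    qed
    have bounds: "norm (a h y) \<le> M * h ^ (r + 1)" "norm (b h y) \<le> M * h ^ (r + 1)"
      if h: "h \<in> {0<..<\<epsilon>}" and y: "y \<in> ball x \<epsilon>" for h y
    proof -
      have "norm (c h y) = h ^ (r + 1) * norm (grad (\<lambda>y. e y h) y)"
        using h by (simp add: c_def orient_def abs_mult)
      also have "\<dots> \<le> h ^ (r + 1) * M" using M[of h y] h y \<epsilon>(3) by (intro mult_left_mono) auto
      finally have "norm (c h y) \<le> M * h ^ (r + 1)" by (simp only: mult.commute)
      then have "norm (fst (c h y)) \<le> M * h ^ (r + 1)" "norm (snd (c h y)) \<le> M * h ^ (r + 1)"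
        using norm_fst_snd_le(1,2)[of "c h y"] by linarith+
      then show "norm (a h y) \<le> M * h ^ (r + 1)" "norm (b h y) \<le> M * h ^ (r + 1)"
        by (auto simp: a_def b_def norm_Pair)
    qed
    have step: "discrete_step right D Hd h z w
        \<longleftrightarrow> z = Z y h 0 + a h y \<and> w = Z y h h + b h y"
      if h: "h \<in> {0<..<\<epsilon>}" and y: "y \<in> ball x \<epsilon>"
        and yzw: "y = (if right then (fst z, snd w) else (fst w, snd z))" for h y z w
    proof -
      let ?Zq = "Z y h (q_time right h)" and ?Zp = "Z y h (p_time right h)"
      define A where "A = (if right then z else w)"
      define B where "B = (if right then w else z)"
      have yAB: "y = (fst A, snd B)" using yzw by (auto simp: A_def B_def)
      have y': "y \<in> ball x \<epsilon>1" "y \<in> ball x \<epsilon>2" and h': "h > 0" "h \<in> {0..<\<epsilon>1}" "h \<in> {0<..<\<epsilon>2}"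
        using y h \<epsilon> by auto
      let ?ge = "grad (\<lambda>y. e y h) y"
      define G where "G = ?\<sigma> *\<^sub>R (snd ?Zq, fst ?Zp) + h ^ (r + 1) *\<^sub>R ?ge"
      have ge: "GDERIV (\<lambda>y. e y h) y :> ?ge"
        using Ck_on_Suc_grad(1)[OF e2[OF h'(3), unfolded numeral_2_eq_2] open_ball y'(2)] .
      have "GDERIV (\<lambda>y. generating right K Z y h + h ^ (r + 1) * e y h) y :> G"
        using GDERIV_add[OF S[OF y'(1) h'(2,1)] GDERIV_mult[OF GDERIV_const[of "h ^ (r + 1)"] ge]]
        by (simp add: G_def)
      then have G: "GDERIV (\<lambda>y. Hd y h) y :> G"
        unfolding gderiv_def
        by (rule has_derivative_transform_within_open[OF _ open_ball y'(2)]) (simp add: Hd[OF h'(3)])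
      have parts: "GDERIV (\<lambda>q. Hd (q, snd B) h) (fst A) :> fst G" "GDERIV (\<lambda>p. Hd (fst A, p) h) (snd B) :> snd G"
        using GDERIV_fst_partial GDERIV_snd_partial G unfolding yAB by blast+
      have uniq: "GDERIV f u :> E \<longleftrightarrow> E = E'" if "GDERIV f u :> E'" for f and u :: "'n ext" and E E'
        using that grad_eqI by metis
      have "fst A = fst y" "snd B = snd y" using yAB by simp_all
      then have AB: "fst A = fst ?Zq" "snd B = snd ?Zp"
        using q[OF y'(1) h'(2)] p[OF y'(1) h'(2)] by simp_all
      have flip: "?\<sigma> *\<^sub>R u = v \<longleftrightarrow> u = ?\<sigma> *\<^sub>R v" for u v :: "'n ext"
        by (auto simp: orient_def)
      have "(fst A, snd B) \<in> D" using y'(1) \<epsilon>1(2) yAB by auto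
      then have "discrete_step right D Hd h z w \<longleftrightarrow> ?\<sigma> *\<^sub>R snd A = fst G \<and> ?\<sigma> *\<^sub>R fst B = snd G"
        unfolding discrete_step_def Let_def A_def[symmetric] B_def[symmetric]
          uniq[OF parts(1)] uniq[OF parts(2)] by blast
      also have "\<dots> \<longleftrightarrow> snd A = ?\<sigma> *\<^sub>R fst G \<and> fst B = ?\<sigma> *\<^sub>R snd G"
        by (simp only: flip)
      also have "\<dots> \<longleftrightarrow> snd A = snd ?Zq + fst (c h y) \<and> fst B = fst ?Zp + snd (c h y)"
        by (simp add: G_def c_def scaleR_add_right \<sigma> mult.commute)
      also have "\<dots> \<longleftrightarrow> A = ?Zq + (0, fst (c h y)) \<and> B = ?Zp + (snd (c h y), 0)"
        unfolding prod_eq_iff[of A] prod_eq_iff[of B] by (simp add: AB)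
      also have "\<dots> \<longleftrightarrow> z = Z y h 0 + a h y \<and> w = Z y h h + b h y"
        by (auto simp: A_def B_def a_def b_def q_time_def p_time_def)
      finally show ?thesis .
    qed
    have data: "y = (if right then (fst (Z y h 0 + a h y), snd (Z y h h + b h y))
          else (fst (Z y h h + b h y), snd (Z y h 0 + a h y)))"
      if "h \<in> {0<..<\<epsilon>}" "y \<in> ball x \<epsilon>" for h y
      using q[of y h] p[of y h] that \<epsilon>
      by (cases right) (simp_all add: a_def b_def q_time_def p_time_def prod_eq_iff[of y])
    show "\<exists>\<epsilon>>0. \<exists>M. \<forall>h\<in>{0<..<\<epsilon>}. continuous_on (ball x \<epsilon>) (a h) \<and>
      (\<forall>y\<in>ball x \<epsilon>. norm (a h y) \<le> M * h ^ (r + 1) \<and> norm (b h y) \<le> M * h ^ (r + 1) \<and>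
      discrete_step right D Hd h (Z y h 0 + a h y) (Z y h h + b h y) \<and>
      (\<forall>z w. discrete_step right D Hd h z w \<longrightarrow> y = (if right then (fst z, snd w) else (fst w, snd z))
        \<longrightarrow> z = Z y h 0 + a h y \<and> w = Z y h h + b h y))"
      using \<epsilon>(1) cont bounds step data by (intro exI[of _ \<epsilon>] exI[of _ M] conjI ballI) blast+
  qed
qed

text \<open>Let \<open>y\<close> be the boundary data of the step from \<open>z\<close> to \<open>F h z\<close> and let \<open>u\<close> be boundary data
of the exact solution starting at \<open>z\<close>. The two exact solutions start \<open>a h y\<close> apart, so their end
points differ by at most \<open>C * norm (a h y)\<close>, and \<open>F h z\<close> differs from the end point of the first
one by \<open>b h y\<close>.\<close>

theorem discrete_map_order_accurate:
  assumes approx: "approximates_to_order r D Hd (generating right K Z)"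
  shows "(\<exists>F. near_identity_map D (discrete_step right D Hd) F)
    \<and> (\<forall>F. near_identity_map D (discrete_step right D Hd) F \<longrightarrow> order_accurate r K D F)"
proof -
  obtain a b where ab: "\<And>x. x \<in> D \<Longrightarrow> \<exists>\<epsilon>>0. \<exists>M. \<forall>h\<in>{0<..<\<epsilon>}.
    continuous_on (ball x \<epsilon>) (a h) \<and>
    (\<forall>y\<in>ball x \<epsilon>. norm (a h y) \<le> M * h ^ (r + 1) \<and> norm (b h y) \<le> M * h ^ (r + 1) \<and>
      discrete_step right D Hd h (Z y h 0 + a h y) (Z y h h + b h y) \<and>
      (\<forall>z w. discrete_step right D Hd h z w \<longrightarrow> y = (if right then (fst z, snd w) else (fst w, snd z))
        \<longrightarrow> z = Z y h 0 + a h y \<and> w = Z y h h + b h y))"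
    using local_discrete_step[OF approx] by metis
  have solve: "\<exists>\<epsilon>>0. \<forall>z\<in>ball x \<epsilon>. \<forall>h\<in>{0<..<\<epsilon>}. \<exists>w. discrete_step right D Hd h z w \<and> dist w x < \<eta>"
    if x: "x \<in> D" and \<eta>: "\<eta> > 0" for x \<eta>
  proof -
    obtain \<epsilon>1 C where loc: "bvp_controlled x \<epsilon>1 C" using bvp_locally_controlled[OF x] by blast
    note \<epsilon>1 = bvp_controlledD(1)[OF loc] and C = bvp_controlledD(2)[OF loc]
      and disp = bvp_controlledD(7)[OF loc] and lip = bvp_controlledD(8)[OF loc]
    obtain \<epsilon>2 M where \<epsilon>2: "\<epsilon>2 > 0"
      and cont: "\<And>h. h \<in> {0<..<\<epsilon>2} \<Longrightarrow> continuous_on (ball x \<epsilon>2) (a h)"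
      and bd: "\<And>h y. h \<in> {0<..<\<epsilon>2} \<Longrightarrow> y \<in> ball x \<epsilon>2 \<Longrightarrow>
          norm (a h y) \<le> M * h ^ (r + 1) \<and> norm (b h y) \<le> M * h ^ (r + 1)"
      and step: "\<And>h y. h \<in> {0<..<\<epsilon>2} \<Longrightarrow> y \<in> ball x \<epsilon>2 \<Longrightarrow>
          discrete_step right D Hd h (Z y h 0 + a h y) (Z y h h + b h y)"
      using ab[OF x] by blast
    define \<delta> where "\<delta> = min (min \<epsilon>1 \<epsilon>2) (\<eta> / 2) / 2"
    have \<delta>: "\<delta> > 0" "\<delta> < \<epsilon>1" "\<delta> < \<epsilon>2" "2 * \<delta> < \<eta>" using \<epsilon>1 \<epsilon>2 \<eta> by (auto simp: \<delta>_def)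
    let ?c = "C + \<bar>M\<bar>"
    \<comment> \<open>Steps \<open>h < t\<close> displace the ball of radius \<open>\<delta>\<close> by at most \<open>\<delta> / 2\<close>.\<close>
    define t where "t = \<delta> / (2 * (?c + 1))"
    have t: "t > 0" using \<delta>(1) C by (simp add: t_def)
    define \<epsilon> where "\<epsilon> = min (min \<delta> 1) t / 2"
    have \<epsilon>: "\<epsilon> > 0" "\<epsilon> < \<delta>" "\<epsilon> < 1" "\<epsilon> \<le> \<delta> / 2" "\<epsilon> < t"
      using \<delta>(1) t by (simp_all add: \<epsilon>_def min_less_iff_disj)
    have "\<exists>w. discrete_step right D Hd h z w \<and> dist w x < \<eta>"
      if z: "z \<in> ball x \<epsilon>" and h: "h \<in> {0<..<\<epsilon>}" for z h
    proof -
      have h12: "h \<in> {0..<\<epsilon>1}" "h \<in> {0<..<\<epsilon>2}" "h > 0" "h \<le> 1" using h \<epsilon> \<delta> by auto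
      have sub: "cball x \<delta> \<subseteq> ball x \<epsilon>1" "cball x \<delta> \<subseteq> ball x \<epsilon>2" using \<delta> by auto
      have "?c * h \<le> ?c * t" using h \<epsilon>(5) C by (intro mult_left_mono) auto
      also have "\<dots> \<le> \<delta> / 2" using \<delta>(1) C by (simp add: t_def field_simps)
      finally have ch: "?c * h \<le> \<delta> / 2" .
      have "h ^ (r + 1) \<le> h" using power_decreasing[of 1 "r + 1" h] h12 by simp
      then have "M * h ^ (r + 1) \<le> \<bar>M\<bar> * h" using h12 by (intro mult_mono) auto
      then have pert: "norm (a h y) \<le> \<bar>M\<bar> * h" "norm (b h y) \<le> \<bar>M\<bar> * h" if "y \<in> cball x \<delta>" for y
        using bd[OF h12(2), of y] sub that by force+
      let ?I = "\<lambda>y. Z y h 0 + a h y"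
      have "C-lipschitz_on (cball x \<delta>) (\<lambda>y. Z y h 0)"
        using lip[OF _ _ h12(1), of _ _ 0] h12 sub C by (intro lipschitz_onI) (auto simp: dist_norm subset_iff)
      then have "continuous_on (cball x \<delta>) ?I"
        by (intro continuous_on_add continuous_on_subset[OF cont[OF h12(2)] sub(2)] lipschitz_on_continuous_on)
      moreover have "norm (?I y - y) \<le> ?c * h" if "y \<in> cball x \<delta>" for y
      proof -
        have "norm (?I y - y) \<le> norm (Z y h 0 - y) + norm (a h y)"
          using norm_triangle_ineq[of "Z y h 0 - y" "a h y"] by (simp add: algebra_simps)
        also have "\<dots> \<le> C * h + \<bar>M\<bar> * h"
          using disp[of y h 0] pert[OF that] that sub h12 by (intro add_mono) auto
        finally show ?thesis by (simp add: algebra_simps)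
      qed
      moreover have "dist z x + ?c * h \<le> \<delta>" using z ch \<epsilon>(4) by (simp add: dist_commute)
      ultimately obtain y where y: "y \<in> cball x \<delta>" "?I y = z"
        using perturbed_identity_surjective[OF \<delta>(1)] by blast
      let ?w = "Z y h h + b h y"
      have "norm (?w - x) \<le> norm (Z y h h - y) + norm (b h y) + norm (y - x)"
        using norm_triangle_ineq[of "Z y h h - y + b h y" "y - x"] norm_triangle_ineq[of "Z y h h - y" "b h y"]
        by (simp add: algebra_simps)
      also have "\<dots> \<le> C * h + \<bar>M\<bar> * h + \<delta>"
        using disp[of y h h] pert[OF y(1)] y(1) sub h12
        by (intro add_mono) (auto simp: dist_norm norm_minus_commute)
      also have "\<dots> < \<eta>" using ch \<delta> by (simp add: algebra_simps)
      finally have "dist ?w x < \<eta>" by (simp add: dist_norm)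
      moreover have "discrete_step right D Hd h z ?w" using step[OF h12(2), of y] y sub by auto
      ultimately show ?thesis by blast
    qed
    then show ?thesis using \<epsilon>(1) by blast
  qed
  have accurate: "order_accurate r K D F" if F: "near_identity_map D (discrete_step right D Hd) F" for F
    unfolding order_accurate_def
  proof
    fix x assume x: "x \<in> D"
    obtain \<epsilon>1 C where loc: "bvp_controlled x \<epsilon>1 C" using bvp_locally_controlled[OF x] by blast
    note \<epsilon>1 = bvp_controlledD(1)[OF loc] and C = bvp_controlledD(2)[OF loc]
      and disp = bvp_controlledD(7)[OF loc] and lip = bvp_controlledD(8)[OF loc]
      and sol = bvp_controlledD(4)[OF loc] and stab = bvp_controlledD(9)[OF loc]
      and uniq = bvp_controlledD(10)[OF loc]
    obtain \<epsilon>2 M where \<epsilon>2: "\<epsilon>2 > 0"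
      and bd: "\<And>h y. h \<in> {0<..<\<epsilon>2} \<Longrightarrow> y \<in> ball x \<epsilon>2 \<Longrightarrow>
          norm (a h y) \<le> M * h ^ (r + 1) \<and> norm (b h y) \<le> M * h ^ (r + 1)"
      and step: "\<And>h y z w. h \<in> {0<..<\<epsilon>2} \<Longrightarrow> y \<in> ball x \<epsilon>2 \<Longrightarrow> discrete_step right D Hd h z w \<Longrightarrow>
          y = (if right then (fst z, snd w) else (fst w, snd z)) \<Longrightarrow>
          z = Z y h 0 + a h y \<and> w = Z y h h + b h y"
      using ab[OF x] by blast
    define \<delta> where "\<delta> = min \<epsilon>1 \<epsilon>2 / 2"
    have \<delta>: "\<delta> > 0" "2 * \<delta> \<le> \<epsilon>1" "2 * \<delta> \<le> \<epsilon>2" using \<epsilon>1 \<epsilon>2 by (auto simp: \<delta>_def)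
    obtain \<epsilon>3 where \<epsilon>3: "\<epsilon>3 > 0" and near: "\<And>z h. z \<in> ball x \<epsilon>3 \<Longrightarrow> h \<in> {0<..<\<epsilon>3} \<Longrightarrow>
        discrete_step right D Hd h z (F h z) \<and> dist (F h z) x < \<delta>"
      using F x \<delta>(1) unfolding near_identity_map_def by blast
    \<comment> \<open>As above, without perturbation: steps \<open>h < t\<close> displace the ball by at most \<open>\<delta> / 2\<close>.\<close>
    define t where "t = \<delta> / (2 * (C + 1))"
    have t: "t > 0" using \<delta>(1) C by (simp add: t_def)
    define \<epsilon> where "\<epsilon> = min (min \<delta> \<epsilon>3) t / 2"
    have \<epsilon>: "\<epsilon> > 0" "\<epsilon> < \<delta>" "\<epsilon> < \<epsilon>3" "\<epsilon> < t" "\<epsilon> \<le> \<delta> / 2"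
      using \<delta>(1) \<epsilon>3 t by (simp_all add: \<epsilon>_def min_less_iff_disj)
    have "(\<exists>!w. flow_rel K D h z w) \<and>
        (\<forall>w. flow_rel K D h z w \<longrightarrow> norm (F h z - w) \<le> (C * M + M) * h ^ (r + 1))"
      if z: "z \<in> ball x \<epsilon>" and h: "h \<in> {0<..<\<epsilon>}" for z h
    proof -
      have h12: "h \<in> {0..<\<epsilon>1}" "h \<in> {0<..<\<epsilon>2}" "h \<in> {0<..<\<epsilon>3}" "h > 0" using h \<epsilon> \<delta> by auto
      have sub: "cball x \<delta> \<subseteq> ball x \<epsilon>1" using \<delta> by auto
      have "C-lipschitz_on (cball x \<delta>) (\<lambda>y. Z y h 0)"
        using lip[OF _ _ h12(1), of _ _ 0] h12 sub C by (intro lipschitz_onI) (auto simp: dist_norm subset_iff)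
      then have "continuous_on (cball x \<delta>) (\<lambda>y. Z y h 0)" by (rule lipschitz_on_continuous_on)
      moreover have "norm (Z y h 0 - y) \<le> C * h" if "y \<in> cball x \<delta>" for y
        using disp[of y h 0] h12 sub that by auto
      moreover have "dist z x + C * h \<le> \<delta>"
      proof -
        have "C * h \<le> C * t" using h \<epsilon>(4) C by (intro mult_left_mono) auto
        also have "\<dots> \<le> \<delta> / 2" using \<delta>(1) C by (simp add: t_def field_simps)
        finally show ?thesis using z \<epsilon>(5) by (simp add: dist_commute)
      qed
      ultimately obtain u where u: "u \<in> cball x \<delta>" "Z u h 0 = z"
        using perturbed_identity_surjective[OF \<delta>(1)] by blast
      have u1: "u \<in> ball x \<epsilon>1" using u(1) sub by blast
      have flow: "flow_rel K D h z w \<longleftrightarrow> w = Z u h h" for w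
        using sol[OF u1 h12(1)] uniq[OF u1 h12(1)] u(2) unfolding flow_rel_def by metis
      define y where "y = (if right then (fst z, snd (F h z)) else (fst (F h z), snd z))"
      have N: "discrete_step right D Hd h z (F h z)" "dist (F h z) x < \<delta>"
        using near[of z h] z \<epsilon>(3) h12(3) by auto
      have "dist y x \<le> dist z x + dist (F h z) x"
        using norm_fst_snd_le[of "y - x"] norm_fst_snd_le[of "z - x"] norm_fst_snd_le[of "F h z - x"]
        by (cases right) (auto simp: y_def dist_norm)
      then have y: "y \<in> ball x \<epsilon>1" "y \<in> ball x \<epsilon>2" using N(2) z \<epsilon>(2) \<delta> by (auto simp: dist_commute)
      have zF: "z = Z y h 0 + a h y" "F h z = Z y h h + b h y"
        using step[OF h12(2) y(2) N(1) y_def] by auto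
      note bdy = bd[OF h12(2) y(2)]
      have "norm (F h z - Z u h h) \<le> norm (Z y h h - Z u h h) + norm (b h y)"
        using norm_triangle_ineq[of "Z y h h - Z u h h" "b h y"] zF(2) by (simp add: algebra_simps)
      also have "\<dots> \<le> C * norm (Z y h 0 - Z u h 0) + norm (b h y)"
        using stab[OF u1 y(1) h12(1)] by simp
      also have "Z y h 0 - Z u h 0 = - a h y" using zF(1) u(2) by simp
      also have "C * norm (- a h y) + norm (b h y) \<le> C * (M * h ^ (r + 1)) + M * h ^ (r + 1)"
        using bdy C by (intro add_mono mult_left_mono) auto
      finally have "norm (F h z - Z u h h) \<le> (C * M + M) * h ^ (r + 1)" by (simp add: algebra_simps)
      then show ?thesis unfolding flow by blast
    qed
    then show "\<exists>C. \<exists>\<epsilon>>0. \<forall>z\<in>ball x \<epsilon>. \<forall>h\<in>{0<..<\<epsilon>}.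
        (\<exists>!w. flow_rel K D h z w) \<and> (\<forall>w. flow_rel K D h z w \<longrightarrow> norm (F h z - w) \<le> C * h ^ (r + 1))"
      using \<epsilon>(1) by blast
  qed
  show ?thesis using near_identity_selection[of D "discrete_step right D Hd"] solve accurate by blast
qed

end

theorem theorem3p2:
  fixes H g :: "'n::finite phase \<Rightarrow> real"
    and U :: "'n phase set"
    and D :: "'n ext_phase set"
    and r :: nat
  assumes "open U"
    and "Ck_on 2 H U" and "nondegenerate_on U H"
    and "Ck_on 1 g U"
    and "\<And>z. z \<in> U \<Longrightarrow>
      det (outer (grad_p H z) (grad_p g z) + g z *\<^sub>R hess_pp H z
           + outer (grad_p g z) (grad_p H z)) \<noteq> 0"
    and "open D" and "D \<subseteq> extend U"
  shows
    "(\<forall>Z Hd. right_bvp_solutions (poincare H g) D Z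
        \<and> smooth_for_small_h D (exact_right (poincare H g) Z)
        \<and> approximates_to_order r D Hd (exact_right (poincare H g) Z)
      \<longrightarrow> (\<exists>F. near_identity_map D (right_step D Hd) F)
        \<and> (\<forall>F. near_identity_map D (right_step D Hd) F
             \<longrightarrow> order_accurate r (poincare H g) D F))
   \<and> (\<forall>Z Hd. left_bvp_solutions (poincare H g) D Z
        \<and> smooth_for_small_h D (exact_left (poincare H g) Z)
        \<and> approximates_to_order r D Hd (exact_left (poincare H g) Z)
      \<longrightarrow> (\<exists>F. near_identity_map D (left_step D Hd) F)
        \<and> (\<forall>F. near_identity_map D (left_step D Hd) F
             \<longrightarrow> order_accurate r (poincare H g) D F))"
proof -
  have C1: "Ck_on 1 (poincare H g) D"
    using Ck_on_subset[OF Ck_on_1_poincare[OF assms(1) Ck_on_2_imp_1[OF assms(2)] assms(4)] assms(7)] .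
  have "(\<exists>F. near_identity_map D (discrete_step right D Hd) F)
      \<and> (\<forall>F. near_identity_map D (discrete_step right D Hd) F \<longrightarrow> order_accurate r (poincare H g) D F)"
    if "boundary_solutions right (poincare H g) D Z"
      "smooth_for_small_h D (generating right (poincare H g) Z)"
      "approximates_to_order r D Hd (generating right (poincare H g) Z)" for right Z Hd
  proof -
    interpret exact_discrete_hamiltonian "poincare H g" D right Z
      by standard (use assms(6) C1 that in auto)
    show ?thesis by (rule discrete_map_order_accurate[OF that(3)])
  qed
  then show ?thesis unfolding boundary_solutions_iff generating_eq discrete_step_eq by blast
qed

end
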